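(* Suppose Assumptions 1--4 of the context hold and the number $\tau$ of local computations per round is fixed. Then for every $\delta>0$ there exists $\varepsilon_{th}>0$ such that, for all $0<\varepsilon<\varepsilon_{th}$ and any state-dependent stationary policy $\boldsymbol\pi:\mathcal C\to[0,q_{\max}]^m$, the expected wall clock time is bounded as $$1-\delta\ \le\ \frac{\mathbb E\big[T_\varepsilon^{\boldsymbol\pi}\big]}{\mathbb E\big[\|\boldsymbol h_\varepsilon(\boldsymbol\pi(C))\|\big]\ \mathbb E\big[d(\tau,\boldsymbol\pi(C),C)\big]}\ \le\ 1+\delta,$$ where $C$ is a random variable with distribution $\mu$.
   Context: Setting. There are $m$ clients, a finite set $\mathcal C$ of network states, a bound $q_{\max}>0$, and a fixed number $\tau$ of local computations per round. A federated learning (FL) algorithm runs in rounds $n=1,2,\dots$; in round $n$ the clients use a vector of compression parameters $\boldsymbol q^{n}\in[0,q_{\max}]^m$, the network state is $c^{n}\in\mathcal C$, and the round has duration $d(\tau,\boldsymbol q^{n},c^{n})>0$. Assumption 1. For the given FL algorithm there exist a norm $\|\cdot\|$ on $\mathbb R^m$ and, for every $\varepsilon>0$, a strictly increasing, continuous, bounded function $h_\varepsilon:[0,q_{\max}]\to\mathbb R^+$ such that, with $\boldsymbol h_\varepsilon(\boldsymbol q)=(h_\varepsilon(q_1),\dots,h_\varepsilon(q_m))$, given any sequence $(\boldsymbol q^{n})_n$ of compression parameters the algorithm has reached error tolerance $\varepsilon$ by round $r$ if and only if $r>\frac1r\sum_{n=1}^r\|\boldsymbol h_\varepsilon(\boldsymbol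 q^{n})\|$. $\boldsymbol h_\varepsilon^{-1}$ denotes the (coordinatewise) inverse of $\boldsymbol h_\varepsilon$. Assumption 2. For any sequence of compression parameters, the minimum number of rounds $r_\varepsilon$ needed to reach error tolerance $\varepsilon$ satisfies $r_\varepsilon=\Theta(1/\mathrm{poly}(\varepsilon))$ as $\varepsilon\to0$, where $\mathrm{poly}(\varepsilon)$ is a polynomial in $\varepsilon$ (vanishing at $0$, so that the number of rounds grows as $\varepsilon\to0$). Assumption 3. For each network state $c$ and $\tau$, the map $\boldsymbol r\mapsto d(\tau,\boldsymbol h_\varepsilon^{-1}(\boldsymbol r),c)$ is bounded, convex in $\boldsymbol r$, and decreasing in every coordinate of $\boldsymbol r$. Assumption 4. The sequence of network states $(C^{n})_n$ is an irreducible aperiodic stationary Markov chain on the finite set $\mathcal C$ with invariant distribution $\mu$. Wall clock time. A state-dependent stationary policy $\boldsymbol\pi$ uses $\boldsymbol q^n=\boldsymbol\pi(C^n)$ in every round $n$. $R_\varepsilon^{\boldsymbol\pi}$ is the minimum number of rounds needed to reach error tolerance $\varepsilon$ under $\boldsymbol\pi$, and $T_\varepsilon^{\boldsymbol\pi}=\sum_{n=1}^{R_\varepsilon^{\boldsymbol\pi}}d(\tau,\boldsymbol\pi(C^n),C^n)$. *)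

theory Defs
  imports
    "HOL-Probability.Probability"
    "HOL-Library.Landau_Symbols"
    "HOL-Computational_Algebra.Polynomial"
begin

text \<open>
  Rounds are numbered from 1: in sequences indexed by \<^typ>\<open>nat\<close> the entry at 0 is never used.
  The network states are the elements of a finite type \<open>'c\<close>, and the clients those of a finite
  type \<open>'m\<close>.
\<close>

subsection \<open>Compression parameters\<close>

definition is_norm :: "('a::real_vector \<Rightarrow> real) \<Rightarrow> bool" where
  "is_norm N \<longleftrightarrow>
     (\<forall>x. 0 \<le> N x) \<and> (\<forall>x. N x = 0 \<longleftrightarrow> x = 0) \<and>
     (\<forall>a x. N (a *\<^sub>R x) = \<bar>a\<bar> * N x) \<and> (\<forall>x y. N (x + y) \<le> N x + N y)"

definition params :: "real \<Rightarrow> (real ^ 'm) set" where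
  "params qmax = {q. \<forall>i. q $ i \<in> {0..qmax}}"

definition param_seq :: "real \<Rightarrow> (nat \<Rightarrow> real ^ 'm) \<Rightarrow> bool" where
  "param_seq qmax q \<longleftrightarrow> (\<forall>n\<ge>1. q n \<in> params qmax)"

definition coordwise :: "(real \<Rightarrow> real) \<Rightarrow> real ^ 'm \<Rightarrow> real ^ 'm" where
  "coordwise f x = (\<chi> i. f (x $ i))"

subsection \<open>The learning algorithm\<close>

text \<open>
  For a fixed number of local computations the algorithm enters only through the relation
  \<open>reached \<epsilon> q r\<close>: run with compression parameters \<open>q\<close>, it has reached error tolerance \<open>\<epsilon>\<close>
  by round \<open>r\<close>.
\<close>

type_synonym 'm fl_algorithm = "real \<Rightarrow> (nat \<Rightarrow> real ^ 'm) \<Rightarrow> nat \<Rightarrow> bool"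

definition min_rounds :: "'m::finite fl_algorithm \<Rightarrow> real \<Rightarrow> (nat \<Rightarrow> real ^ 'm) \<Rightarrow> nat" where
  "min_rounds reached \<epsilon> q = (LEAST r. 1 \<le> r \<and> reached \<epsilon> q r)"

definition convergence_criterion ::
    "real \<Rightarrow> 'm::finite fl_algorithm \<Rightarrow> (real ^ 'm \<Rightarrow> real) \<Rightarrow> (real \<Rightarrow> real \<Rightarrow> real) \<Rightarrow> bool" where
  "convergence_criterion qmax reached N h \<longleftrightarrow>
     is_norm N \<and>
     (\<forall>\<epsilon>>0.
        (\<forall>x\<in>{0..qmax}. 0 < h \<epsilon> x) \<and>
        strict_mono_on {0..qmax} (h \<epsilon>) \<and>
        continuous_on {0..qmax} (h \<epsilon>) \<and>
        bounded (h \<epsilon> ` {0..qmax}) \<and>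
        (\<forall>q. param_seq qmax q \<longrightarrow>
          (\<forall>r\<ge>1. reached \<epsilon> q r \<longleftrightarrow>
             real r > 1 / real r * (\<Sum>n=1..r. N (coordwise (h \<epsilon>) (q n))))))"

definition polynomial_rounds :: "real \<Rightarrow> 'm::finite fl_algorithm \<Rightarrow> bool" where
  "polynomial_rounds qmax reached \<longleftrightarrow>
     (\<forall>q. param_seq qmax q \<longrightarrow>
        (\<exists>p :: real poly. p \<noteq> 0 \<and> poly p 0 = 0 \<and>
           (\<lambda>\<epsilon>. real (min_rounds reached \<epsilon> q)) \<in> \<Theta>[at_right 0](\<lambda>\<epsilon>. 1 / poly p \<epsilon>)))"

subsection \<open>Round durations\<close>

definition decreasing_coordwise_on :: "(real ^ 'm) set \<Rightarrow> (real ^ 'm \<Rightarrow> real) \<Rightarrow> bool" where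
  "decreasing_coordwise_on S f \<longleftrightarrow>
     (\<forall>x\<in>S. \<forall>y\<in>S. \<forall>i. x $ i \<le> y $ i \<and> (\<forall>j. j \<noteq> i \<longrightarrow> x $ j = y $ j) \<longrightarrow> f y \<le> f x)"

text \<open>
  The map \<open>r \<mapsto> d(\<tau>, h\<^sub>\<epsilon>\<^sup>-\<^sup>1(r), c)\<close> is considered on the range of \<open>h\<^sub>\<epsilon>\<close> over the admissible
  parameters, where the inverse is defined.
\<close>

definition duration_regular ::
    "real \<Rightarrow> (real \<Rightarrow> real \<Rightarrow> real) \<Rightarrow> (nat \<Rightarrow> real ^ 'm \<Rightarrow> 'c \<Rightarrow> real) \<Rightarrow> nat \<Rightarrow> bool" where
  "duration_regular qmax h d \<tau> \<longleftrightarrow>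
     (\<forall>\<epsilon>>0. \<forall>c.
        let S = coordwise (h \<epsilon>) ` params qmax;
            f = (\<lambda>r. d \<tau> (coordwise (the_inv_into {0..qmax} (h \<epsilon>)) r) c)
        in bounded (f ` S) \<and> convex_on S f \<and> decreasing_coordwise_on S f)"

subsection \<open>Markov chains on a finite state space\<close>

definition step_pmf :: "('c \<Rightarrow> 'c pmf) \<Rightarrow> nat \<Rightarrow> 'c \<Rightarrow> 'c pmf" where
  "step_pmf K n x = ((\<lambda>p. bind_pmf p K) ^^ n) (return_pmf x)"

definition irreducible_kernel :: "('c \<Rightarrow> 'c pmf) \<Rightarrow> bool" where
  "irreducible_kernel K \<longleftrightarrow> (\<forall>x y. \<exists>n. pmf (step_pmf K n x) y > 0)"

definition aperiodic_kernel :: "('c \<Rightarrow> 'c pmf) \<Rightarrow> bool" where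
  "aperiodic_kernel K \<longleftrightarrow> (\<forall>x. Gcd {n. 1 \<le> n \<and> pmf (step_pmf K n x) x > 0} = 1)"

definition markov_chain :: "'w measure \<Rightarrow> (nat \<Rightarrow> 'w \<Rightarrow> 'c) \<Rightarrow> ('c \<Rightarrow> 'c pmf) \<Rightarrow> bool" where
  "markov_chain M C K \<longleftrightarrow>
     prob_space M \<and>
     (\<forall>n\<ge>1. C n \<in> measurable M (count_space UNIV)) \<and>
     (\<forall>n\<ge>1. \<forall>x y.
        measure M {\<omega>\<in>space M. \<forall>i\<in>{1..n}. C i \<omega> = x i} > 0 \<longrightarrow>
        \<P>(\<omega> in M. C (Suc n) \<omega> = y \<bar> \<forall>i\<in>{1..n}. C i \<omega> = x i) = pmf (K (x n)) y)"

definition stationary_markov_chain ::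
    "'w measure \<Rightarrow> (nat \<Rightarrow> 'w \<Rightarrow> 'c) \<Rightarrow> ('c \<Rightarrow> 'c pmf) \<Rightarrow> 'c pmf \<Rightarrow> bool" where
  "stationary_markov_chain M C K \<mu> \<longleftrightarrow>
     markov_chain M C K \<and>
     bind_pmf \<mu> K = \<mu> \<and>
     distr M (count_space UNIV) (C 1) = measure_pmf \<mu>"

subsection \<open>Wall clock time\<close>

definition policy_params :: "('c \<Rightarrow> real ^ 'm) \<Rightarrow> (nat \<Rightarrow> 'w \<Rightarrow> 'c) \<Rightarrow> 'w \<Rightarrow> nat \<Rightarrow> real ^ 'm" where
  "policy_params \<pi> C \<omega> = (\<lambda>n. \<pi> (C n \<omega>))"

definition wall_clock ::
    "'m::finite fl_algorithm \<Rightarrow> (nat \<Rightarrow> real ^ 'm \<Rightarrow> 'c \<Rightarrow> real) \<Rightarrow> nat \<Rightarrow> (nat \<Rightarrow> 'w \<Rightarrow> 'c) \<Rightarrow>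
     real \<Rightarrow> ('c \<Rightarrow> real ^ 'm) \<Rightarrow> 'w \<Rightarrow> real" where
  "wall_clock reached d \<tau> C \<epsilon> \<pi> \<omega> =
     (\<Sum>n = 1..min_rounds reached \<epsilon> (policy_params \<pi> C \<omega>). d \<tau> (\<pi> (C n \<omega>)) (C n \<omega>))"

end

theory Submission
  imports Defs
begin

text \<open>
  Write \<open>x c\<close> for the norm of \<open>h\<^sub>\<epsilon>(\<pi> c)\<close>, \<open>y c\<close> for the duration of a round in state \<open>c\<close>, and
  \<open>\<rho>\<close>, \<open>\<Delta>\<close> for their means under \<open>\<mu>\<close>. A solution \<open>g\<close> of the Poisson equation
  \<open>g - K g = f - E\<^sub>\<mu> f\<close> turns sums of \<open>f\<close> along the chain into a martingale with bounded
  increments, so that Hoeffding's lemma and Borel-Cantelli give the ergodic theorem. Since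
  \<open>\<mu> c > 0\<close> for every \<open>c\<close>, with high probability all visit frequencies are, from some round \<open>n0\<close>
  on, within a factor \<open>1 \<plusminus> \<eta>\<close> of \<open>\<mu>\<close>; then the averages of \<open>x\<close> and \<open>y\<close> are within the same
  factor of their means for all nonnegative \<open>x\<close> and \<open>y\<close> at once, which makes every estimate
  uniform in the policy.

  Run with constant parameters 0, the algorithm needs a number of rounds that tends to infinity
  with \<open>1/\<epsilon>\<close>; hence \<open>h\<^sub>\<epsilon>(0)\<close>, and by equivalence of norms the minimum of \<open>x\<close> over all policies,
  tends to infinity. Once it exceeds \<open>n0\<close>, the algorithm stops after \<open>n0\<close>, the stopping round is
  close to \<open>\<rho>\<close>, and the wall clock time is close to \<open>\<rho> \<Delta>\<close>. On the exceptional event it is at most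
  \<open>2 \<rho> \<Delta> / m\<^sup>2\<close> for \<open>m = min \<mu>\<close>, because \<open>x \<le> \<rho> / m\<close> and \<open>y \<le> \<Delta> / m\<close>.
\<close>

section \<open>Norms on Euclidean space\<close>

text \<open>One half of the equivalence of norms. Expanding in the basis gives
  \<open>N x \<le> B * norm x\<close>, so \<open>N\<close> is Lipschitz and attains its minimum on
  the unit sphere; that minimum is positive by definiteness, and homogeneity carries it to all
  vectors.\<close>

lemma is_norm_lower_bound:
  fixes N :: "'a::euclidean_space \<Rightarrow> real"
  assumes "is_norm N"
  obtains \<kappa> where "\<kappa> > 0" "\<And>x. \<kappa> * norm x \<le> N x"
proof -
  have nonneg: "0 \<le> N x" and zero: "N x = 0 \<longleftrightarrow> x = 0" and scale: "N (a *\<^sub>R x) = \<bar>a\<bar> * N x"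
    and tri: "N (x + y) \<le> N x + N y" for x y a
    using assms unfolding is_norm_def by blast+
  have N_sum: "N (\<Sum>i\<in>I. f i) \<le> (\<Sum>i\<in>I. N (f i))" if "finite I" for I :: "'a set" and f
    using that
  proof induction
    case empty
    then show ?case using zero[of 0] by simp
  next
    case (insert i I)
    then show ?case using tri[of "f i" "sum f I"] by simp
  qed
  define B where "B = (\<Sum>b\<in>Basis. N b)"
  have upper: "N x \<le> B * norm x" for x
  proof -
    have "N x = N (\<Sum>b\<in>Basis. (x \<bullet> b) *\<^sub>R b)" by (simp add: euclidean_representation)
    also have "\<dots> \<le> (\<Sum>b\<in>Basis. N ((x \<bullet> b) *\<^sub>R b))" by (rule N_sum) simp
    also have "\<dots> \<le> (\<Sum>b\<in>Basis. norm x * N b)"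
      by (intro sum_mono) (simp add: scale nonneg Basis_le_norm mult_right_mono)
    finally show ?thesis by (simp add: B_def sum_distrib_left mult.commute)
  qed
  have "B \<ge> 0" by (simp add: B_def nonneg sum_nonneg)
  have "\<bar>N x - N y\<bar> \<le> B * norm (x - y)" for x y
    using tri[of "x - y" y] tri[of "y - x" x] upper[of "x - y"] upper[of "y - x"]
    by (simp add: norm_minus_commute)
  then have "B-lipschitz_on UNIV N"
    using \<open>B \<ge> 0\<close> by (intro lipschitz_onI) (auto simp: dist_norm)
  then have cont: "continuous_on (sphere 0 1) N"
    using lipschitz_on_continuous_on continuous_on_subset by blast
  obtain u where u: "u \<in> sphere 0 1" "\<And>x. x \<in> sphere 0 1 \<Longrightarrow> N u \<le> N x"
    using continuous_attains_inf[OF compact_sphere _ cont] by auto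
  show thesis
  proof
    show "N u > 0" using u(1) nonneg[of u] zero[of u] by (cases "u = 0") auto
    show "N u * norm x \<le> N x" for x
    proof (cases "x = 0")
      case False
      have "N u \<le> N ((1 / norm x) *\<^sub>R x)" using False by (intro u(2)) simp
      also have "\<dots> = N x / norm x" by (simp add: scale)
      finally show ?thesis using False by (simp add: field_simps)
    qed (simp add: nonneg)
  qed
qed

section \<open>Finite Markov chains\<close>

lemma expectation_finite_pmf:
  fixes f :: "'c::finite \<Rightarrow> real"
  shows "measure_pmf.expectation p f = (\<Sum>x\<in>UNIV. pmf p x * f x)"
  by (subst integral_measure_pmf_real[of UNIV]) (auto simp: mult.commute)

lemma expectation_invariant:
  fixes f :: "'c::finite \<Rightarrow> real"
  assumes "bind_pmf \<mu> K = \<mu>"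
  shows "measure_pmf.expectation \<mu> (\<lambda>x. measure_pmf.expectation (K x) f) =
    measure_pmf.expectation \<mu> f"
proof -
  have inv: "(\<Sum>x\<in>UNIV. pmf \<mu> x * pmf (K x) y) = pmf \<mu> y" for y
    using arg_cong[OF assms, of "\<lambda>p. pmf p y"] by (simp add: pmf_bind expectation_finite_pmf)
  have "(\<Sum>y\<in>UNIV. pmf \<mu> y * f y) = (\<Sum>y\<in>UNIV. \<Sum>x\<in>UNIV. pmf \<mu> x * pmf (K x) y * f y)"
    by (simp add: sum_distrib_right[symmetric] inv)
  also have "\<dots> = (\<Sum>x\<in>UNIV. pmf \<mu> x * (\<Sum>y\<in>UNIV. pmf (K x) y * f y))"
    by (subst sum.swap) (simp add: sum_distrib_left mult.assoc)
  finally show ?thesis by (simp add: expectation_finite_pmf)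
qed

lemma set_step_pmf_closed:
  assumes "\<And>x y. x \<in> A \<Longrightarrow> y \<in> set_pmf (K x) \<Longrightarrow> y \<in> A" "x \<in> A"
  shows "set_pmf (step_pmf K n x) \<subseteq> A"
  by (induction n) (use assms in \<open>auto simp: step_pmf_def\<close>)

text \<open>A chain cannot leave a closed set, yet irreducibility lets it reach every state.
  Irreducibility enters in this form: for the support of an invariant distribution and for the
  maximisers of a harmonic function.\<close>

lemma irreducible_closed_UNIV:
  assumes "irreducible_kernel K" "\<And>x y. x \<in> A \<Longrightarrow> y \<in> set_pmf (K x) \<Longrightarrow> y \<in> A" "A \<noteq> {}"
  shows "A = UNIV"
proof -
  obtain x where "x \<in> A" using assms(3) by blast
  have "y \<in> A" for y
  proof -
    obtain n where "pmf (step_pmf K n x) y > 0"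
      using assms(1) unfolding irreducible_kernel_def by blast
    then have "y \<in> set_pmf (step_pmf K n x)" by (simp add: set_pmf_iff)
    then show ?thesis using set_step_pmf_closed[of A K x n] assms(2) \<open>x \<in> A\<close> by blast
  qed
  then show ?thesis by blast
qed

lemma invariant_pmf_pos:
  assumes "irreducible_kernel K" "bind_pmf \<mu> K = \<mu>"
  shows "pmf \<mu> x > 0"
proof -
  have "y \<in> set_pmf \<mu>" if "x \<in> set_pmf \<mu>" "y \<in> set_pmf (K x)" for x y
    using that assms(2) by (metis UN_I set_bind_pmf)
  then have "set_pmf \<mu> = UNIV"
    using irreducible_closed_UNIV[OF assms(1)] set_pmf_not_empty[of \<mu>] by metis
  then show ?thesis by (metis UNIV_I pmf_positive)
qed

text \<open>Maximum principle. At a maximiser the nonnegative gaps \<open>m - g z\<close> average to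
  zero under \<open>K x\<close>, so they vanish on its support, and the set of maximisers is closed
  under the chain.\<close>

lemma harmonic_const:
  fixes g :: "'c::finite \<Rightarrow> real"
  assumes "irreducible_kernel K" and harm: "\<And>x. measure_pmf.expectation (K x) g = g x"
  shows "g x = g y"
proof -
  define m where "m = Max (range g)"
  have le: "g x \<le> m" for x by (simp add: m_def)
  have "{x. g x = m} = UNIV"
  proof (rule irreducible_closed_UNIV[OF assms(1)])
    show "{x. g x = m} \<noteq> {}" using Max_in[of "range g"] by (auto simp: m_def image_iff intro: sym)
    fix x y assume x: "x \<in> {x. g x = m}" and y: "y \<in> set_pmf (K x)"
    have "(\<Sum>z\<in>UNIV. pmf (K x) z * (m - g z)) = m * (\<Sum>z\<in>UNIV. pmf (K x) z) - g x"
      using harm[of x]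
      by (simp add: expectation_finite_pmf right_diff_distrib sum_subtractf sum_distrib_left
          mult.commute[of m])
    also have "\<dots> = 0" using x by (simp add: sum_pmf_eq_1)
    finally have "pmf (K x) y * (m - g y) = 0"
      by (subst (asm) sum_nonneg_eq_0_iff) (auto simp: le)
    then show "y \<in> {x. g x = m}" using y by (simp add: set_pmf_iff)
  qed
  then show ?thesis by (metis UNIV_I mem_Collect_eq)
qed

text \<open>
  Adding the rank-one term \<open>E\<^sub>\<mu> g\<close> to \<open>I - K\<close> makes the operator injective, hence bijective;
  invariance of \<open>\<mu>\<close> then forces \<open>E\<^sub>\<mu> g = 0\<close> for the solution.
\<close>

lemma poisson_equation:
  fixes f :: "'c::finite \<Rightarrow> real"
  assumes irr: "irreducible_kernel K" and inv: "bind_pmf \<mu> K = \<mu>"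
    and mean: "measure_pmf.expectation \<mu> f = 0"
  obtains g where "\<And>x. f x = g x - measure_pmf.expectation (K x) g"
proof -
  let ?E = "measure_pmf.expectation"
  define L :: "real ^ 'c \<Rightarrow> real ^ 'c"
    where "L v = (\<chi> x. v $ x - ?E (K x) (($) v) + ?E \<mu> (($) v))" for v
  have mean_L: "?E \<mu> (($) (L v)) = ?E \<mu> (($) v)" for v
  proof -
    have int: "integrable (measure_pmf \<mu>) F" for F :: "'c \<Rightarrow> real"
      by (rule integrable_measure_pmf_finite) simp
    have "?E \<mu> (($) (L v)) = ?E \<mu> (\<lambda>x. v $ x - ?E (K x) (($) v) + ?E \<mu> (($) v))"
      by (intro Bochner_Integration.integral_cong) (simp_all add: L_def)
    also have "\<dots> = ?E \<mu> (($) v) - ?E \<mu> (\<lambda>x. ?E (K x) (($) v)) + ?E \<mu> (($) v)"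
      by (simp add: int)
    finally show ?thesis by (simp add: expectation_invariant[OF inv])
  qed
  have "?E p (($) (v + w)) = ?E p (($) v) + ?E p (($) w)" for p and v w :: "real ^ 'c"
    by (simp add: expectation_finite_pmf distrib_left sum.distrib)
  moreover have "?E p (($) (a *\<^sub>R v)) = a * ?E p (($) v)" for p a and v :: "real ^ 'c"
    by (simp add: expectation_finite_pmf sum_distrib_left mult.left_commute)
  ultimately have "linear L"
    by (intro linearI) (simp_all add: L_def vec_eq_iff algebra_simps)
  \<comment> \<open>On the kernel of \<open>L\<close> the mean under \<open>\<mu>\<close> vanishes,
    so \<open>v\<close> is harmonic, hence constant, and a constant of mean zero is zero.\<close>
  moreover have "v = 0" if "L v = 0" for v
  proof -
    have 0: "?E \<mu> (($) v) = 0" using mean_L[of v] that by (simp add: expectation_finite_pmf)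
    then have "?E (K x) (($) v) = v $ x" for x
      using that by (simp add: L_def vec_eq_iff)
    then have const: "v $ x = v $ y" for x y
      using harmonic_const[OF irr] by blast
    have "v $ x = 0" for x
    proof -
      have "?E \<mu> (($) v) = ?E \<mu> (\<lambda>_. v $ x)"
        by (rule Bochner_Integration.integral_cong[OF refl const])
      then show ?thesis using 0 by simp
    qed
    then show ?thesis by (simp add: vec_eq_iff)
  qed
  ultimately have "surj L"
    by (intro linear_injective_imp_surjective) (auto simp: linear_injective_0)
  then obtain v where v: "L v = (\<chi> x. f x)" by (metis surjD)
  have "?E \<mu> (($) v) = 0" using mean_L[of v] mean by (simp add: v expectation_finite_pmf)
  then have "f x = v $ x - ?E (K x) (($) v)" for x
    using v by (simp add: L_def vec_eq_iff)
  then show thesis by (rule that)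
qed

text \<open>Hoeffding's lemma on \<open>{-B..B}\<close>: the length \<open>2 * B\<close> turns its
  exponent \<open>l\<^sup>2 * (2 * B)\<^sup>2 / 8\<close> into
  \<open>l\<^sup>2 * B\<^sup>2 / 2\<close>.\<close>

lemma hoeffding_finite_pmf:
  fixes g :: "'c::finite \<Rightarrow> real"
  assumes "l > 0" "\<And>x. \<bar>g x\<bar> \<le> B"
  shows "measure_pmf.expectation p (\<lambda>y. exp (l * (g y - measure_pmf.expectation p g)))
    \<le> exp (l\<^sup>2 * B\<^sup>2 / 2)"
proof -
  have bounds: "-B \<le> g x \<and> g x \<le> B" for x
    using assms(2)[of x] by linarith
  have "interval_bounded_random_variable (measure_pmf p) g (-B) B"
  proof (intro interval_bounded_random_variable.intro interval_bounded_random_variable_axioms.intro)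
    show "AE x in measure_pmf p. g x \<in> {-B..B}"
      by (rule AE_pmfI) (simp only: atLeastAtMost_iff bounds)
  qed (simp_all add: measure_pmf.prob_space_axioms)
  note Hoeffding = interval_bounded_random_variable.Hoeffdings_lemma_nn_integral[OF this assms(1)]
  let ?F = "\<lambda>y. exp (l * (g y - measure_pmf.expectation p g))"
  have "ennreal (measure_pmf.expectation p ?F) = (\<integral>\<^sup>+y. ennreal (?F y) \<partial>measure_pmf p)"
    by (intro nn_integral_eq_integral[symmetric] integrable_measure_pmf_finite) auto
  also have "\<dots> \<le> ennreal (exp (l\<^sup>2 * (B - - B)\<^sup>2 / 8))"
    by (rule Hoeffding)
  finally have "measure_pmf.expectation p ?F \<le> exp (l\<^sup>2 * (B - - B)\<^sup>2 / 8)"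
    by (simp add: ennreal_le_iff)
  also have "l\<^sup>2 * (B - - B)\<^sup>2 / 8 = l\<^sup>2 * B\<^sup>2 / 2"
    by (simp add: power2_eq_square)
  finally show ?thesis .
qed

section \<open>The Markov property along finite paths\<close>

lemma markov_chain_prob_space: "markov_chain M C K \<Longrightarrow> prob_space M"
  by (simp add: markov_chain_def)

lemma markov_chain_measurable:
  "markov_chain M C K \<Longrightarrow> n \<ge> 1 \<Longrightarrow> C n \<in> measurable M (count_space UNIV)"
  by (simp add: markov_chain_def)

lemma sets_path:
  assumes "markov_chain M C K"
  shows "{\<omega>\<in>space M. \<forall>i\<in>{1..n}. C i \<omega> = x i} \<in> sets M"
proof -
  have "C i -` {x i} \<inter> space M \<in> sets M" if "i \<in> {1..n}" for i
    using measurable_sets[OF markov_chain_measurable[OF assms]] that by simp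
  then have "{\<omega>\<in>space M. C i \<omega> = x i} \<in> sets M" if "i \<in> {1..n}" for i
    using that by (simp add: vimage_def Int_def conj_commute)
  then show ?thesis by (intro sets.sets_Collect_finite_All) auto
qed

text \<open>The Markov property in product form. For a path of probability zero the conditional
  probability says nothing, but then both sides vanish.\<close>

lemma path_step_measure:
  assumes mc: "markov_chain M C K" and "n \<ge> 1"
  shows "measure M {\<omega>\<in>space M. (\<forall>i\<in>{1..n}. C i \<omega> = x i) \<and> C (Suc n) \<omega> = y} =
    measure M {\<omega>\<in>space M. \<forall>i\<in>{1..n}. C i \<omega> = x i} * pmf (K (x n)) y"
    (is "measure M ?B = measure M ?A * _")
proof (cases "measure M ?A > 0")
  case True
  then have "\<P>(\<omega> in M. C (Suc n) \<omega> = y \<bar> \<forall>i\<in>{1..n}. C i \<omega> = x i) = pmf (K (x n)) y"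
    using mc \<open>n \<ge> 1\<close> unfolding markov_chain_def by blast
  moreover have "?B = {\<omega>\<in>space M. C (Suc n) \<omega> = y \<and> (\<forall>i\<in>{1..n}. C i \<omega> = x i)}" by blast
  ultimately show ?thesis using True by (simp add: cond_prob_def field_simps)
next
  case False
  interpret prob_space M using mc by (rule markov_chain_prob_space)
  have "measure M ?B \<le> measure M ?A"
    by (intro finite_measure_mono sets_path[OF mc]) auto
  moreover have 0: "measure M ?A = 0" using False by (simp only: zero_less_measure_iff not_not)
  ultimately have "measure M ?B = 0" by (simp only: measure_le_0_iff)
  then show ?thesis by (simp only: 0 mult_zero_left)
qed

text \<open>Conditioning on the first \<open>n\<close> states without conditional expectations. By
  \<open>local\<close>, \<open>F\<close> depends on these states only, so both integrals are finite
  sums over paths of length \<open>n\<close>, and \<open>path_step_measure\<close> matches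
  them.\<close>

lemma expectation_path_step:
  fixes C :: "nat \<Rightarrow> 'w \<Rightarrow> 'c::finite" and F :: "(nat \<Rightarrow> 'c) \<Rightarrow> real"
  assumes mc: "markov_chain M C K" and "n \<ge> 1"
    and local: "\<And>x y. (\<And>i. i \<in> {1..n} \<Longrightarrow> x i = y i) \<Longrightarrow> F x = F y"
  shows "(\<integral>\<omega>. F (\<lambda>i. C i \<omega>) * \<phi> (C n \<omega>) (C (Suc n) \<omega>) \<partial>M) =
      (\<integral>\<omega>. F (\<lambda>i. C i \<omega>) * measure_pmf.expectation (K (C n \<omega>)) (\<phi> (C n \<omega>)) \<partial>M)"
proof -
  interpret prob_space M using mc by (rule markov_chain_prob_space)
  \<comment> \<open>\<open>PiE\<close> fixes the values outside \<open>{1..n}\<close>, so each path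
    has exactly one representative and there are finitely many.\<close>
  define \<Omega> where "\<Omega> = PiE {1..n} (\<lambda>_. UNIV :: 'c set)"
  define A where "A x = {\<omega>\<in>space M. \<forall>i\<in>{1..n}. C i \<omega> = x i}" for x
  define B where "B x y = {\<omega>\<in>space M. (\<forall>i\<in>{1..n}. C i \<omega> = x i) \<and> C (Suc n) \<omega> = y}" for x y
  have [simp]: "finite \<Omega>" unfolding \<Omega>_def by (intro finite_PiE) auto
  have A_sets [measurable]: "A x \<in> sets M" for x
    unfolding A_def by (rule sets_path[OF mc])
  have B_eq: "B x y = A x \<inter> (C (Suc n) -` {y} \<inter> space M)" for x y
    by (auto simp: A_def B_def)
  have B_sets [measurable]: "B x y \<in> sets M" for x y
    unfolding B_eq
    by (rule sets.Int[OF A_sets measurable_sets[OF markov_chain_measurable[OF mc]]]) simp_all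
  \<comment> \<open>The events \<open>A x\<close> with \<open>x\<close> in \<open>\<Omega>\<close>
    partition the space: only the restriction of the actual trajectory has indicator 1.\<close>
  have split_A: "G (\<lambda>i. C i \<omega>) = (\<Sum>x\<in>\<Omega>. G x * indicator (A x) \<omega>)"
    if "\<omega> \<in> space M" and G: "\<And>x y. (\<And>i. i \<in> {1..n} \<Longrightarrow> x i = y i) \<Longrightarrow> G x = G y"
    for \<omega> and G :: "(nat \<Rightarrow> 'c) \<Rightarrow> real"
  proof -
    define x where "x = restrict (\<lambda>i. C i \<omega>) {1..n}"
    have "x \<in> \<Omega>" by (simp add: x_def \<Omega>_def)
    have "indicator (A x') \<omega> = (if x' = x then 1 else 0 :: real)" if "x' \<in> \<Omega>" for x'
    proof -
      have "\<omega> \<in> A x' \<longleftrightarrow> (\<forall>i\<in>{1..n}. x' i = x i)"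
        using \<open>\<omega> \<in> space M\<close> by (auto simp: A_def x_def)
      also have "\<dots> \<longleftrightarrow> x' = x"
        using that \<open>x \<in> \<Omega>\<close> unfolding \<Omega>_def by (metis PiE_ext)
      finally show ?thesis by (simp add: indicator_def)
    qed
    then have "(\<Sum>x'\<in>\<Omega>. G x' * indicator (A x') \<omega>) = (\<Sum>x'\<in>\<Omega>. if x' = x then G x' else 0)"
      by (intro sum.cong) auto
    also have "\<dots> = G x" using \<open>x \<in> \<Omega>\<close> by simp
    also have "\<dots> = G (\<lambda>i. C i \<omega>)" by (rule G) (simp add: x_def)
    finally show ?thesis by simp
  qed
  have F_mult: "F x * \<psi> (x n) = F y * \<psi> (y n)" if "\<And>i. i \<in> {1..n} \<Longrightarrow> x i = y i" for x y \<psi>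
    using local[OF that] that[of n] \<open>n \<ge> 1\<close> by simp
  have B_split: "indicator (A x) \<omega> * \<phi> (x n) (C (Suc n) \<omega>) =
      (\<Sum>y\<in>UNIV. \<phi> (x n) y * indicator (B x y) \<omega>)" if "\<omega> \<in> space M" for x \<omega>
  proof -
    have "(\<Sum>y\<in>UNIV. \<phi> (x n) y * indicator (B x y) \<omega>) =
        (\<Sum>y\<in>UNIV. if y = C (Suc n) \<omega> then \<phi> (x n) y * indicator (A x) \<omega> else 0)"
      using that by (intro sum.cong) (auto simp: B_eq indicator_def)
    then show ?thesis by simp
  qed
  have "(\<integral>\<omega>. F (\<lambda>i. C i \<omega>) * \<phi> (C n \<omega>) (C (Suc n) \<omega>) \<partial>M) =
      (\<integral>\<omega>. (\<Sum>x\<in>\<Omega>. \<Sum>y\<in>UNIV. F x * \<phi> (x n) y * indicator (B x y) \<omega>) \<partial>M)"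
  proof (intro Bochner_Integration.integral_cong refl)
    fix \<omega> assume \<omega>: "\<omega> \<in> space M"
    have "F (\<lambda>i. C i \<omega>) * \<phi> (C n \<omega>) (C (Suc n) \<omega>) =
        (\<Sum>x\<in>\<Omega>. F x * \<phi> (x n) (C (Suc n) \<omega>) * indicator (A x) \<omega>)"
      by (rule split_A[OF \<omega>, of "\<lambda>x. F x * \<phi> (x n) (C (Suc n) \<omega>)"]) (rule F_mult)
    also have "\<dots> = (\<Sum>x\<in>\<Omega>. F x * (indicator (A x) \<omega> * \<phi> (x n) (C (Suc n) \<omega>)))"
      by (simp add: mult_ac)
    finally show "F (\<lambda>i. C i \<omega>) * \<phi> (C n \<omega>) (C (Suc n) \<omega>) =
        (\<Sum>x\<in>\<Omega>. \<Sum>y\<in>UNIV. F x * \<phi> (x n) y * indicator (B x y) \<omega>)"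
      by (simp only: B_split[OF \<omega>] sum_distrib_left mult.assoc)
  qed
  also have "\<dots> = (\<Sum>x\<in>\<Omega>. \<Sum>y\<in>UNIV. F x * \<phi> (x n) y * measure M (B x y))"
    by (simp add: emeasure_eq_measure del: sum_mult_indicator sum_indicator_mult)
  also have "\<dots> = (\<Sum>x\<in>\<Omega>. F x * measure_pmf.expectation (K (x n)) (\<phi> (x n)) * measure M (A x))"
    using path_step_measure[OF mc \<open>n \<ge> 1\<close>]
    by (simp add: A_def B_def expectation_finite_pmf sum_distrib_left sum_distrib_right mult_ac)
  also have "\<dots> = (\<integral>\<omega>. (\<Sum>x\<in>\<Omega>. F x * measure_pmf.expectation (K (x n)) (\<phi> (x n)) *
      indicator (A x) \<omega>) \<partial>M)"
    by (simp add: emeasure_eq_measure del: sum_mult_indicator sum_indicator_mult)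
  also have "\<dots> = (\<integral>\<omega>. F (\<lambda>i. C i \<omega>) * measure_pmf.expectation (K (C n \<omega>)) (\<phi> (C n \<omega>)) \<partial>M)"
    by (intro Bochner_Integration.integral_cong refl
        split_A[symmetric, of _ "\<lambda>x. F x * measure_pmf.expectation (K (x n)) (\<phi> (x n))"])
       (assumption, rule F_mult)
  finally show ?thesis .
qed

section \<open>Exponential bounds for the martingale\<close>

text \<open>Given the states up to time \<open>i\<close>, the increment \<open>D i\<close> has mean
  zero, so \<open>exp (l * D i)\<close> has conditional mean at most
  \<open>exp (l\<^sup>2 * B\<^sup>2 / 2)\<close>. Induction peels off the last factor; integrability
  follows from boundedness of the increments.\<close>

lemma martingale_exp_moment:
  fixes C :: "nat \<Rightarrow> 'w \<Rightarrow> 'c::finite" and g :: "'c \<Rightarrow> real"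
  assumes mc: "markov_chain M C K" and "l > 0" and B: "\<And>x. \<bar>g x\<bar> \<le> B"
  defines "D \<equiv> \<lambda>i \<omega>. g (C (Suc i) \<omega>) - measure_pmf.expectation (K (C i \<omega>)) g"
  shows "integrable M (\<lambda>\<omega>. exp (l * (\<Sum>i=1..n. D i \<omega>))) \<and>
    (\<integral>\<omega>. exp (l * (\<Sum>i=1..n. D i \<omega>)) \<partial>M) \<le> exp (l\<^sup>2 * B\<^sup>2 / 2) ^ n"
proof -
  interpret prob_space M using mc by (rule markov_chain_prob_space)
  note C_meas = markov_chain_measurable[OF mc]
  have D_meas: "D i \<in> borel_measurable M" if "i \<ge> 1" for i
    unfolding D_def using C_meas[of i] C_meas[of "Suc i"] that by simp
  have E_le: "\<bar>measure_pmf.expectation p g\<bar> \<le> B" for p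
  proof -
    have g: "g x \<le> B" "-B \<le> g x" for x using B[of x] by linarith+
    have "integrable (measure_pmf p) g" by (rule integrable_measure_pmf_finite) simp
    then have "measure_pmf.expectation p g \<le> B" "-B \<le> measure_pmf.expectation p g"
      using g by (auto intro: measure_pmf.integral_le_const measure_pmf.integral_ge_const)
    then show ?thesis by linarith
  qed
  have D_le: "\<bar>D i \<omega>\<bar> \<le> 2 * B" for i \<omega>
    unfolding D_def using B[of "C (Suc i) \<omega>"] E_le[of "K (C i \<omega>)"] by linarith
  have int: "integrable M (\<lambda>\<omega>. exp (l * (\<Sum>i=1..n. D i \<omega>)))" for n
  proof (rule integrable_const_bound[where B = "exp (l * (n * (2 * B)))"])
    have "(\<Sum>i=1..n. D i \<omega>) \<le> n * (2 * B)" for \<omega>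
    proof -
      have "(\<Sum>i=1..n. D i \<omega>) \<le> (\<Sum>i=1..n. 2 * B)"
        using D_le by (intro sum_mono) (meson abs_le_D1)
      then show ?thesis by simp
    qed
    then show "AE \<omega> in M. norm (exp (l * (\<Sum>i=1..n. D i \<omega>))) \<le> exp (l * (n * (2 * B)))"
      using \<open>l > 0\<close> by simp
    have [measurable]: "(\<lambda>\<omega>. \<Sum>i=1..n. D i \<omega>) \<in> borel_measurable M"
      by (rule borel_measurable_sum) (simp add: D_meas)
    show "(\<lambda>\<omega>. exp (l * (\<Sum>i=1..n. D i \<omega>))) \<in> borel_measurable M"
      by measurable
  qed
  have "(\<integral>\<omega>. exp (l * (\<Sum>i=1..n. D i \<omega>)) \<partial>M) \<le> exp (l\<^sup>2 * B\<^sup>2 / 2) ^ n"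
  proof (induction n)
    case 0
    then show ?case by (simp add: prob_space)
  next
    case (Suc n)
    let ?b = "exp (l\<^sup>2 * B\<^sup>2 / 2)"
    \<comment> \<open>The first \<open>n\<close> increments involve the states 1 to
      \<open>Suc n\<close>; the conditioning therefore happens at index \<open>Suc n\<close>, which
      is positive even for \<open>n = 0\<close>.\<close>
    define F where "F x = exp (l * (\<Sum>i\<in>{1..<Suc n}. g (x (Suc i)) - measure_pmf.expectation (K (x i)) g))"
      for x :: "nat \<Rightarrow> 'c"
    define \<phi> where "\<phi> x y = exp (l * (g y - measure_pmf.expectation (K x) g))" for x y
    have F_eq: "F (\<lambda>i. C i \<omega>) = exp (l * (\<Sum>i=1..n. D i \<omega>))" for \<omega>
      by (simp add: F_def D_def atLeastLessThanSuc_atLeastAtMost)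
    have \<phi>_le: "measure_pmf.expectation (K x) (\<phi> x) \<le> ?b" for x
      unfolding \<phi>_def using hoeffding_finite_pmf[OF \<open>l > 0\<close> B] .
    have "(\<integral>\<omega>. exp (l * (\<Sum>i=1..Suc n. D i \<omega>)) \<partial>M) =
        (\<integral>\<omega>. F (\<lambda>i. C i \<omega>) * \<phi> (C (Suc n) \<omega>) (C (Suc (Suc n)) \<omega>) \<partial>M)"
      by (intro Bochner_Integration.integral_cong)
         (simp_all add: F_eq \<phi>_def D_def distrib_left exp_add)
    also have "\<dots> = (\<integral>\<omega>. F (\<lambda>i. C i \<omega>) *
        measure_pmf.expectation (K (C (Suc n) \<omega>)) (\<phi> (C (Suc n) \<omega>)) \<partial>M)"
      by (rule expectation_path_step[OF mc])
         (auto simp: F_def intro!: sum.cong arg_cong2[of _ _ _ _ "\<lambda>x y. g x - measure_pmf.expectation (K y) g"])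
    also have "\<dots> \<le> (\<integral>\<omega>. F (\<lambda>i. C i \<omega>) * ?b \<partial>M)"
    proof (rule integral_mono)
      let ?e = "\<lambda>\<omega>. measure_pmf.expectation (K (C (Suc n) \<omega>)) (\<phi> (C (Suc n) \<omega>))"
      have "(\<lambda>\<omega>. ?e \<omega>) \<in> borel_measurable M"
        using measurable_compose[OF C_meas[of "Suc n"],
            of "\<lambda>x. measure_pmf.expectation (K x) (\<phi> x)" borel] by simp
      moreover have "norm (?e \<omega>) \<le> ?b" for \<omega>
        using \<phi>_le by (simp add: \<phi>_def)
      ultimately show "integrable M (\<lambda>\<omega>. F (\<lambda>i. C i \<omega>) * ?e \<omega>)"
        unfolding F_eq
        by (intro Bochner_Integration.integrable_bound[OF integrable_mult_left[OF int[of n], of ?b]]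
            borel_measurable_times AE_I2)
           (auto simp: abs_mult borel_measurable_integrable[OF int] simp del: One_nat_def)
    qed (simp_all only: F_eq integrable_mult_left[OF int] mult_left_mono[OF \<phi>_le] exp_ge_zero)
    also have "\<dots> = (\<integral>\<omega>. exp (l * (\<Sum>i=1..n. D i \<omega>)) \<partial>M) * ?b"
      by (simp add: F_eq)
    also have "\<dots> \<le> ?b ^ n * ?b" by (intro mult_right_mono Suc.IH) simp
    finally show ?case by (simp add: mult.commute)
  qed
  with int show ?thesis by blast
qed

text \<open>Chernoff's inequality bounds the probability of a deviation \<open>t * n\<close> by
  \<open>\<rho> ^ n\<close> with \<open>\<rho> < 1\<close>; these bounds are summable and
  Borel-Cantelli applies. One side is enough, since the other follows by changing the sign of the
  function.\<close>

lemma AE_martingale_small: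
  fixes C :: "nat \<Rightarrow> 'w \<Rightarrow> 'c::finite" and g :: "'c \<Rightarrow> real"
  assumes mc: "markov_chain M C K" and "t > 0"
  defines "D \<equiv> \<lambda>i \<omega>. g (C (Suc i) \<omega>) - measure_pmf.expectation (K (C i \<omega>)) g"
  shows "AE \<omega> in M. eventually (\<lambda>n. (\<Sum>i=1..n. D i \<omega>) < t * real n) sequentially"
proof -
  interpret prob_space M using mc by (rule markov_chain_prob_space)
  \<comment> \<open>The added 1 keeps \<open>B\<close> positive when \<open>g\<close> vanishes, so
    that \<open>l\<close> below is positive.\<close>
  define B where "B = (\<Sum>x\<in>UNIV. \<bar>g x\<bar>) + 1"
  have B: "\<bar>g x\<bar> \<le> B" for x
    using member_le_sum[of x UNIV "\<lambda>x. \<bar>g x\<bar>"] by (simp add: B_def)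
  have "B > 0" unfolding B_def by (simp add: sum_nonneg add_nonneg_pos)
  \<comment> \<open>This \<open>l\<close> minimises the Chernoff exponent
    \<open>l\<^sup>2 * B\<^sup>2 / 2 - l * t\<close>.\<close>
  define l where "l = t / B\<^sup>2"
  have "l > 0" using \<open>t > 0\<close> \<open>B > 0\<close> by (simp add: l_def)
  have int: "integrable M (\<lambda>\<omega>. exp (l * (\<Sum>i=1..n. D i \<omega>)))"
    and moment: "(\<integral>\<omega>. exp (l * (\<Sum>i=1..n. D i \<omega>)) \<partial>M) \<le> exp (l\<^sup>2 * B\<^sup>2 / 2) ^ n" for n
    unfolding D_def using martingale_exp_moment[where g = g, OF mc \<open>l > 0\<close> B] by blast+
  have D_meas: "D i \<in> borel_measurable M" if "i \<ge> 1" for i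
    unfolding D_def using markov_chain_measurable[OF mc, of i] markov_chain_measurable[OF mc, of "Suc i"] that
    by simp
  have S_meas [measurable]: "(\<lambda>\<omega>. \<Sum>i=1..n. D i \<omega>) \<in> borel_measurable M" for n
    by (rule borel_measurable_sum) (simp add: D_meas)
  define A where "A n = {\<omega>\<in>space M. t * real n \<le> (\<Sum>i=1..n. D i \<omega>)}" for n
  have A_sets: "A n \<in> sets M" for n unfolding A_def by measurable
  define \<rho> where "\<rho> = exp (- (t\<^sup>2 / (2 * B\<^sup>2)))"
  have "measure M (A n) \<le> \<rho> ^ n" for n
  proof -
    have "measure M (A n) \<le> exp (- l * (t * real n)) *
        (\<integral>\<omega>\<in>space M. exp (l * (\<Sum>i=1..n. D i \<omega>)) \<partial>M)"
      unfolding A_def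
      by (rule Chernoff_ineq_ge[OF \<open>l > 0\<close>])
         (unfold set_integrable_def, intro integrable_mult_indicator int sets.top, rule sets.top)
    also have "\<dots> \<le> exp (- l * (t * real n)) * exp (l\<^sup>2 * B\<^sup>2 / 2) ^ n"
      using moment[of n] by (simp add: set_integral_space[OF int] del: One_nat_def)
    also have "\<dots> = exp (real n * (l\<^sup>2 * B\<^sup>2 / 2 - l * t))"
      by (simp add: exp_of_nat_mult[symmetric] exp_add[symmetric] algebra_simps)
    also have "l\<^sup>2 * B\<^sup>2 / 2 - l * t = - (t\<^sup>2 / (2 * B\<^sup>2))"
      using \<open>B > 0\<close> by (simp add: l_def field_simps power2_eq_square)
    finally show ?thesis by (simp only: \<rho>_def exp_of_nat_mult)
  qed
  moreover have "\<rho> \<ge> 0" "\<rho> < 1" using \<open>t > 0\<close> \<open>B > 0\<close> by (simp_all add: \<rho>_def)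
  ultimately have "summable (\<lambda>n. measure M (A n))"
    by (intro summable_comparison_test'[OF summable_geometric[of \<rho>]]) auto
  then have "AE \<omega> in M. eventually (\<lambda>n. \<omega> \<in> space M - A n) sequentially"
    by (intro borel_cantelli_AE1 A_sets) (auto simp: emeasure_eq_measure)
  then show ?thesis
    by eventually_elim (auto simp: A_def elim!: eventually_mono)
qed

section \<open>The ergodic theorem and uniform visit frequencies\<close>

text \<open>With \<open>g\<close> from the Poisson equation the sum of \<open>f\<close> is the
  martingale plus a telescoping term of size at most \<open>2 * B\<close>. Each is given half of the
  allowance \<open>t * n\<close>, which for the second requires
  \<open>n \<ge> 4 * B / t\<close>.\<close>

lemma AE_centered_sum_small:
  fixes C :: "nat \<Rightarrow> 'w \<Rightarrow> 'c::finite" and f :: "'c \<Rightarrow> real"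
  assumes mc: "markov_chain M C K" and irr: "irreducible_kernel K" and inv: "bind_pmf \<mu> K = \<mu>"
    and mean: "measure_pmf.expectation \<mu> f = 0" and "t > 0"
  shows "AE \<omega> in M. eventually (\<lambda>n. (\<Sum>i=1..n. f (C i \<omega>)) < t * real n) sequentially"
proof -
  obtain g where g: "\<And>x. f x = g x - measure_pmf.expectation (K x) g"
    using poisson_equation[OF irr inv mean] by blast
  define B where "B = (\<Sum>x\<in>UNIV. \<bar>g x\<bar>)"
  have B: "\<bar>g x\<bar> \<le> B" for x
    using member_le_sum[of x UNIV "\<lambda>x. \<bar>g x\<bar>"] by (simp add: B_def)
  define D where "D i \<omega> = g (C (Suc i) \<omega>) - measure_pmf.expectation (K (C i \<omega>)) g" for i \<omega>
  have decomp: "(\<Sum>i=1..n. f (C i \<omega>)) = g (C 1 \<omega>) - g (C (Suc n) \<omega>) + (\<Sum>i=1..n. D i \<omega>)" for n \<omega>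
    by (induction n) (simp_all add: g D_def)
  have bound: "(\<Sum>i=1..n. f (C i \<omega>)) < t * real n"
    if "(\<Sum>i=1..n. D i \<omega>) < t / 2 * real n" "4 * B / t \<le> real n" for n \<omega>
  proof -
    have "2 * B \<le> t / 2 * real n" using that(2) \<open>t > 0\<close> by (simp add: field_simps)
    then show ?thesis
      using decomp[where n = n and \<omega> = \<omega>] that(1) B[of "C 1 \<omega>"] B[of "C (Suc n) \<omega>"] by (simp add: abs_le_iff)
  qed
  have large: "eventually (\<lambda>n. 4 * B / t \<le> real n) sequentially"
    using filterlim_real_sequentially unfolding filterlim_at_top by blast
  have "AE \<omega> in M. eventually (\<lambda>n. (\<Sum>i=1..n. D i \<omega>) < t / 2 * real n) sequentially"
    unfolding D_def using AE_martingale_small[OF mc, of "t / 2" g] \<open>t > 0\<close> by simp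
  then show ?thesis
  proof eventually_elim
    case (elim \<omega>)
    then show ?case using large by eventually_elim (rule bound)
  qed
qed

lemma markov_chain_ergodic:
  fixes C :: "nat \<Rightarrow> 'w \<Rightarrow> 'c::finite" and f :: "'c \<Rightarrow> real"
  assumes mc: "markov_chain M C K" and irr: "irreducible_kernel K" and inv: "bind_pmf \<mu> K = \<mu>"
  shows "AE \<omega> in M. (\<lambda>n. (\<Sum>i=1..n. f (C i \<omega>)) / real n) \<longlonglongrightarrow> measure_pmf.expectation \<mu> f"
proof -
  define m where "m = measure_pmf.expectation \<mu> f"
  have int: "integrable (measure_pmf \<mu>) f" by (rule integrable_measure_pmf_finite) simp
  \<comment> \<open>Only the countably many tolerances \<open>1 / (k + 1)\<close> are used, so the
    exceptional null sets can be united. The two signs of the centred function give the two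
    sides.\<close>
  have "AE \<omega> in M. \<forall>k. eventually (\<lambda>n. \<bar>(\<Sum>i=1..n. f (C i \<omega>)) - real n * m\<bar> < inverse (real (Suc k)) * real n)
      sequentially"
  proof (rule AE_all_countable[THEN iffD2], rule allI)
    fix k
    have "AE \<omega> in M. eventually (\<lambda>n. (\<Sum>i=1..n. f (C i \<omega>) - m) < inverse (real (Suc k)) * real n) sequentially"
      using AE_centered_sum_small[OF mc irr inv, of "\<lambda>x. f x - m"] int by (simp add: m_def)
    moreover have "AE \<omega> in M. eventually (\<lambda>n. (\<Sum>i=1..n. m - f (C i \<omega>)) < inverse (real (Suc k)) * real n) sequentially"
      using AE_centered_sum_small[OF mc irr inv, of "\<lambda>x. m - f x"] int by (simp add: m_def)
    ultimately show "AE \<omega> in M. eventually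
        (\<lambda>n. \<bar>(\<Sum>i=1..n. f (C i \<omega>)) - real n * m\<bar> < inverse (real (Suc k)) * real n) sequentially"
    proof eventually_elim
      case (elim \<omega>)
      then show ?case
        by eventually_elim (simp add: sum_subtractf abs_less_iff)
    qed
  qed
  then show ?thesis
  proof eventually_elim
    case (elim \<omega>)
    show ?case unfolding m_def[symmetric]
    proof (rule tendstoI)
      fix e :: real assume "e > 0"
      then obtain k where k: "inverse (real (Suc k)) < e" using reals_Archimedean by blast
      have "eventually (\<lambda>n. n > 0) sequentially" by (rule eventually_gt_at_top)
      with elim[rule_format, of k]
      show "eventually (\<lambda>n. dist ((\<Sum>i=1..n. f (C i \<omega>)) / real n) m < e) sequentially"
      proof eventually_elim
        case (elim n)
        have "\<bar>(\<Sum>i=1..n. f (C i \<omega>)) / real n - m\<bar> = \<bar>(\<Sum>i=1..n. f (C i \<omega>)) - real n * m\<bar> / real n"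
          using elim(2) by (simp add: field_simps abs_divide[symmetric])
        also have "\<dots> < inverse (real (Suc k))" using elim by (simp add: divide_less_eq)
        finally show ?case using k by (simp add: dist_real_def)
      qed
    qed
  qed
qed

text \<open>An Egorov argument: the events that all frequencies are accurate from \<open>n0\<close>
  on increase with \<open>n0\<close> to an event of probability 1, so by continuity from below one
  of them has probability at least \<open>1 - \<kappa>\<close>.\<close>

lemma uniform_visit_frequencies:
  fixes C :: "nat \<Rightarrow> 'w \<Rightarrow> 'c::finite"
  assumes mc: "markov_chain M C K" and irr: "irreducible_kernel K" and inv: "bind_pmf \<mu> K = \<mu>"
    and "\<eta> > 0" "\<kappa> > 0"
  obtains n0 G where "G \<in> sets M" "measure M G \<ge> 1 - \<kappa>"
    "\<forall>\<omega>\<in>G. \<forall>n\<ge>n0. \<forall>c.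
      \<bar>(\<Sum>i=1..n. indicator {c} (C i \<omega>)) - pmf \<mu> c * real n\<bar> \<le> \<eta> * pmf \<mu> c * real n"
proof -
  interpret prob_space M using mc by (rule markov_chain_prob_space)
  define P where "P n \<omega> \<longleftrightarrow> (\<forall>c. \<bar>(\<Sum>i=1..n. indicator {c} (C i \<omega>)) - pmf \<mu> c * real n\<bar> \<le>
    \<eta> * pmf \<mu> c * real n)" for n \<omega>
  define G where "G n0 = {\<omega>\<in>space M. \<forall>n\<ge>n0. P n \<omega>}" for n0
  have [measurable]: "(\<lambda>\<omega>. \<Sum>i=1..n. indicator {c} (C i \<omega>) :: real) \<in> borel_measurable M" for n c
    by (intro borel_measurable_sum measurable_compose[OF markov_chain_measurable[OF mc]]) auto
  have G_sets: "G n0 \<in> sets M" for n0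
    unfolding G_def P_def by measurable
  have "AE \<omega> in M. \<forall>c. (\<lambda>n. (\<Sum>i=1..n. indicator {c} (C i \<omega>)) / real n) \<longlonglongrightarrow> pmf \<mu> c"
    using markov_chain_ergodic[OF mc irr inv, of "indicator {_}"]
    by (intro AE_all_countable[THEN iffD2] allI) (simp add: measure_pmf_single)
  then have "AE \<omega> in M. \<omega> \<in> (\<Union>n0. G n0)"
    using AE_space
  proof eventually_elim
    case (elim \<omega>)
    have "eventually (\<lambda>n. \<bar>(\<Sum>i=1..n. indicator {c} (C i \<omega>)) - pmf \<mu> c * real n\<bar> \<le>
        \<eta> * pmf \<mu> c * real n) sequentially" for c
    proof -
      \<comment> \<open>The error is measured relative to \<open>pmf \<mu> c\<close>, which is
        possible because no state has mass zero.\<close>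
      have "\<eta> * pmf \<mu> c > 0" using invariant_pmf_pos[OF irr inv] \<open>\<eta> > 0\<close> by simp
      then have "eventually (\<lambda>n. dist ((\<Sum>i=1..n. indicator {c} (C i \<omega>)) / real n) (pmf \<mu> c) < \<eta> * pmf \<mu> c) sequentially"
        using elim(1) tendstoD by blast
      then show ?thesis using eventually_gt_at_top[of 0]
      proof eventually_elim
        case (elim n)
        let ?s = "\<Sum>i=1..n. indicator {c} (C i \<omega>) :: real"
        have "\<bar>?s - pmf \<mu> c * real n\<bar> = \<bar>?s / real n - pmf \<mu> c\<bar> * \<bar>real n\<bar>"
          using elim(2) by (simp only: abs_mult[symmetric] left_diff_distrib) simp
        also have "\<dots> \<le> \<eta> * pmf \<mu> c * \<bar>real n\<bar>"
          using elim(1) by (intro mult_right_mono) (simp_all add: dist_real_def)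
        finally show ?case by simp
      qed
    qed
    then have "eventually (\<lambda>n. P n \<omega>) sequentially"
      unfolding P_def by (rule eventually_all_finite)
    then show ?case using elim(2) by (auto simp: G_def eventually_sequentially)
  qed
  then have "prob (\<Union>n0. G n0) = 1"
    using G_sets by (subst AE_in_set_eq_1[symmetric]) auto
  moreover have "incseq G" by (auto simp: G_def incseq_def)
  ultimately have "(\<lambda>n0. prob (G n0)) \<longlonglongrightarrow> 1"
    using finite_Lim_measure_incseq[of G] G_sets by auto
  then have "eventually (\<lambda>n0. prob (G n0) > 1 - \<kappa>) sequentially"
    using \<open>\<kappa> > 0\<close> by (intro order_tendstoD) auto
  then obtain n0 where n0: "prob (G n0) > 1 - \<kappa>"
    unfolding eventually_sequentially by blast
  show thesis
  proof (rule that[OF G_sets])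
    show "prob (G n0) \<ge> 1 - \<kappa>" using n0 by simp
    show "\<forall>\<omega>\<in>G n0. \<forall>n\<ge>n0. \<forall>c.
        \<bar>(\<Sum>i=1..n. indicator {c} (C i \<omega>)) - pmf \<mu> c * real n\<bar> \<le> \<eta> * pmf \<mu> c * real n"
      unfolding G_def P_def by blast
  qed
qed

section \<open>Stopping round\<close>

text \<open>The stopping rule with the convergence criterion multiplied by \<open>r\<close>. It
  makes the number of rounds a function of the sequence of norms alone.\<close>

definition first_passage :: "(nat \<Rightarrow> real) \<Rightarrow> nat" where
  "first_passage u = (LEAST r. 1 \<le> r \<and> (\<Sum>n=1..r. u n) < (real r)\<^sup>2)"

lemma first_passage_le:
  "1 \<le> r \<Longrightarrow> (\<Sum>n=1..r. u n) < (real r)\<^sup>2 \<Longrightarrow> first_passage u \<le> r"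
  unfolding first_passage_def by (rule Least_le) simp

text \<open>Any round \<open>r > b\<close> passes, because the sum is at most
  \<open>r * b < r\<^sup>2\<close>. So the \<open>LEAST\<close> is attained, and the first integer
  above \<open>b\<close> gives the bound.\<close>

lemma first_passage_bounded:
  assumes u: "\<And>n. n \<ge> 1 \<Longrightarrow> u n \<le> b" and "0 \<le> b"
  shows "1 \<le> first_passage u"
    and "(\<Sum>n=1..first_passage u. u n) < (real (first_passage u))\<^sup>2"
    and "real (first_passage u) \<le> b + 1"
proof -
  define r where "r = nat \<lfloor>b\<rfloor> + 1"
  have r: "1 \<le> r" "b < real r" "real r \<le> b + 1" unfolding r_def using \<open>0 \<le> b\<close> by linarith+
  have "(\<Sum>n=1..r. u n) \<le> (\<Sum>n=1..r. b)" using u by (intro sum_mono) auto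
  also have "\<dots> = real r * b" by simp
  also have "\<dots> < real r * real r" using r by (intro mult_strict_left_mono) auto
  finally have r_pass: "(\<Sum>n=1..r. u n) < (real r)\<^sup>2" by (simp only: power2_eq_square)
  then have "1 \<le> first_passage u \<and> (\<Sum>n=1..first_passage u. u n) < (real (first_passage u))\<^sup>2"
    unfolding first_passage_def using r(1)
    by (intro LeastI[of "\<lambda>r. 1 \<le> r \<and> (\<Sum>n=1..r. u n) < (real r)\<^sup>2"]) simp
  then show "1 \<le> first_passage u"
    and "(\<Sum>n=1..first_passage u. u n) < (real (first_passage u))\<^sup>2" by blast+
  have "real (first_passage u) \<le> real r"
    using first_passage_le[OF r(1) r_pass] by simp
  then show "real (first_passage u) \<le> b + 1" using r(3) by linarith
qed

lemma min_rounds_eq_first_passage: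
  assumes "convergence_criterion qmax reached N h" "\<epsilon> > 0" "param_seq qmax q"
  shows "min_rounds reached \<epsilon> q = first_passage (\<lambda>n. N (coordwise (h \<epsilon>) (q n)))"
proof -
  have "reached \<epsilon> q r \<longleftrightarrow> (\<Sum>n=1..r. N (coordwise (h \<epsilon>) (q n))) < (real r)\<^sup>2" if "1 \<le> r" for r
  proof -
    have "reached \<epsilon> q r \<longleftrightarrow> real r > 1 / real r * (\<Sum>n=1..r. N (coordwise (h \<epsilon>) (q n)))"
      using assms that unfolding convergence_criterion_def by blast
    also have "\<dots> \<longleftrightarrow> (\<Sum>n=1..r. N (coordwise (h \<epsilon>) (q n))) < (real r)\<^sup>2"
      using that by (simp add: divide_less_eq power2_eq_square)
    finally show ?thesis .
  qed
  then have "(\<lambda>r. 1 \<le> r \<and> reached \<epsilon> q r) =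
      (\<lambda>r. 1 \<le> r \<and> (\<Sum>n=1..r. N (coordwise (h \<epsilon>) (q n))) < (real r)\<^sup>2)" by blast
  then show ?thesis unfolding min_rounds_def first_passage_def by (simp only:)
qed

section \<open>Growth as the tolerance vanishes\<close>

text \<open>The lower half of \<open>\<Theta>\<close> bounds the rounds below by a multiple of
  \<open>1 / \<bar>poly p \<epsilon>\<bar>\<close>, and the denominator tends to
  \<open>poly p 0 = 0\<close>.\<close>

lemma polynomial_rounds_at_top:
  assumes "polynomial_rounds qmax reached" "param_seq qmax q"
  shows "filterlim (\<lambda>\<epsilon>. real (min_rounds reached \<epsilon> q)) at_top (at_right 0)"
proof -
  obtain p :: "real poly" where p: "p \<noteq> 0" "poly p 0 = 0"
    and \<Theta>: "(\<lambda>\<epsilon>. real (min_rounds reached \<epsilon> q)) \<in> \<Theta>[at_right 0](\<lambda>\<epsilon>. 1 / poly p \<epsilon>)"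
    using assms unfolding polynomial_rounds_def by blast
  from \<Theta> have "(\<lambda>\<epsilon>. real (min_rounds reached \<epsilon> q)) \<in> \<Omega>[at_right 0](\<lambda>\<epsilon>. 1 / poly p \<epsilon>)" by blast
  then obtain c where c: "c > 0"
    "eventually (\<lambda>\<epsilon>. norm (real (min_rounds reached \<epsilon> q)) \<ge> c * norm (1 / poly p \<epsilon>)) (at_right 0)"
    by (rule landau_omega.bigE)
  \<comment> \<open>Roots must be kept away from a punctured neighbourhood of 0, since at a root
    \<open>1 / poly p \<epsilon>\<close> is 0 by convention and the lower bound is void.\<close>
  have "\<not> (0::real) islimpt {x. poly p x = 0}"
    by (rule islimpt_finite[OF poly_roots_finite[OF p(1)]])
  then have nz: "eventually (\<lambda>\<epsilon>. poly p \<epsilon> \<noteq> 0) (at_right 0)"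
    unfolding islimpt_iff_eventually by (simp add: eventually_at_split)
  have "((\<lambda>\<epsilon>. poly p \<epsilon>) \<longlongrightarrow> poly p 0) (at_right 0)"
    by (intro tendsto_intros)
  then have lim: "((\<lambda>\<epsilon>. poly p \<epsilon>) \<longlongrightarrow> 0) (at_right 0)" using p(2) by simp
  show ?thesis unfolding filterlim_at_top_gt[where c = 0]
  proof (intro allI impI)
    fix Z :: real assume "Z > 0"
    have "eventually (\<lambda>\<epsilon>. norm (poly p \<epsilon>) < c / Z) (at_right 0)"
      using tendstoD[OF lim, of "c / Z"] \<open>c > 0\<close> \<open>Z > 0\<close> by simp
    with c(2) nz show "eventually (\<lambda>\<epsilon>. Z \<le> real (min_rounds reached \<epsilon> q)) (at_right 0)"
    proof eventually_elim
      case (elim \<epsilon>)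
      have "Z \<le> c * norm (1 / poly p \<epsilon>)"
        using elim(2,3) \<open>c > 0\<close> \<open>Z > 0\<close> by (simp add: field_simps)
      then show ?case using elim(1) by simp
    qed
  qed
qed

text \<open>Constant parameters 0 need at most \<open>h \<epsilon> 0 * N e + 1\<close> rounds, so
  \<open>h \<epsilon> 0\<close> must diverge. As \<open>N\<close> may fail to be monotone in the
  coordinates, the passage to other parameters goes through the Euclidean norm, which dominates
  every coordinate.\<close>

lemma criterion_norm_large:
  fixes N :: "real ^ 'm::finite \<Rightarrow> real"
  assumes "qmax > 0" and conv: "convergence_criterion qmax reached N h"
    and poly: "polynomial_rounds qmax reached"
  shows "eventually (\<lambda>\<epsilon>. \<forall>q\<in>params qmax. A \<le> N (coordwise (h \<epsilon>) q)) (at_right 0)"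
proof -
  have norm: "is_norm N" using conv unfolding convergence_criterion_def by blast
  obtain \<kappa> where \<kappa>: "\<kappa> > 0" "\<And>x. \<kappa> * norm x \<le> N x" using is_norm_lower_bound[OF norm] by blast
  define e :: "real ^ 'm" where "e = (\<chi> i. 1)"
  have "e \<noteq> 0" by (simp add: e_def vec_eq_iff)
  then have "N e > 0" using norm unfolding is_norm_def by (metis order_less_le)
  have zero: "(0 :: real ^ 'm) \<in> params qmax" using \<open>qmax > 0\<close> by (simp add: params_def)
  then have seq: "param_seq qmax (\<lambda>_. 0 :: real ^ 'm)" by (simp add: param_seq_def)
  \<comment> \<open>The 1 pays for rounding in the bound on the rounds; the rest becomes
    \<open>A \<le> \<kappa> * h \<epsilon> 0\<close>.\<close>
  have "eventually (\<lambda>\<epsilon>. A * N e / \<kappa> + 1 \<le> real (min_rounds reached \<epsilon> (\<lambda>_. 0))) (at_right 0)"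
    using polynomial_rounds_at_top[OF poly seq] unfolding filterlim_at_top by blast
  then show ?thesis using eventually_at_right_less
  proof eventually_elim
    case (elim \<epsilon>)
    have h: "0 < h \<epsilon> x" if "x \<in> {0..qmax}" for x
      using conv elim(2) that unfolding convergence_criterion_def by blast
    have mono: "strict_mono_on {0..qmax} (h \<epsilon>)"
      using conv elim(2) unfolding convergence_criterion_def by blast
    have h0: "0 < h \<epsilon> 0" using h \<open>qmax > 0\<close> by simp
    have "coordwise (h \<epsilon>) 0 = h \<epsilon> 0 *\<^sub>R e" by (simp add: coordwise_def e_def vec_eq_iff)
    then have "N (coordwise (h \<epsilon>) 0) = h \<epsilon> 0 * N e"
      using norm h0 unfolding is_norm_def by simp
    then have "real (min_rounds reached \<epsilon> (\<lambda>_. 0)) \<le> h \<epsilon> 0 * N e + 1"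
      unfolding min_rounds_eq_first_passage[OF conv elim(2) seq]
      using h0 \<open>N e > 0\<close> by (intro first_passage_bounded(3)) auto
    with elim(1) have "A * N e / \<kappa> \<le> h \<epsilon> 0 * N e" by linarith
    then have A: "A \<le> \<kappa> * h \<epsilon> 0" using \<open>N e > 0\<close> \<kappa>(1) by (simp add: field_simps)
    show ?case
    proof
      fix q :: "real ^ 'm" assume q: "q \<in> params qmax"
      fix i :: 'm
      have qi: "q $ i \<in> {0..qmax}" using q by (simp add: params_def)
      have "h \<epsilon> 0 \<le> h \<epsilon> (q $ i)"
        using strict_mono_on_leD[OF mono] qi \<open>qmax > 0\<close> by simp
      also have "\<dots> \<le> norm (coordwise (h \<epsilon>) q)"
        using component_le_norm_cart[of "coordwise (h \<epsilon>) q" i] by (simp add: coordwise_def)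
      finally have "\<kappa> * h \<epsilon> 0 \<le> \<kappa> * norm (coordwise (h \<epsilon>) q)"
        using \<kappa>(1) by (intro mult_left_mono) auto
      then show "A \<le> N (coordwise (h \<epsilon>) q)" using A \<kappa>(2)[of "coordwise (h \<epsilon>) q"] by linarith
    qed
  qed
qed

section \<open>Wall clock time along a path\<close>

lemma sum_along_path:
  fixes f :: "'c::finite \<Rightarrow> real"
  shows "(\<Sum>i=1..n. f (s i)) = (\<Sum>c\<in>UNIV. f c * (\<Sum>i=1..n. indicator {c} (s i)))"
proof -
  have "f (s i) = (\<Sum>c\<in>UNIV. f c * indicator {c} (s i))" for i
    by (simp add: indicator_def if_distrib cong: if_cong)
  then have "(\<Sum>i=1..n. f (s i)) = (\<Sum>i=1..n. \<Sum>c\<in>UNIV. f c * indicator {c} (s i))" by metis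
  also have "\<dots> = (\<Sum>c\<in>UNIV. \<Sum>i=1..n. f c * indicator {c} (s i))" by (rule sum.swap)
  finally show ?thesis by (simp only: sum_distrib_left)
qed

text \<open>A path sum is a combination of visit counts with nonnegative coefficients
  \<open>f c\<close>, so the relative error of the counts passes to every such \<open>f\<close> at
  once.\<close>

lemma sum_along_typical_path:
  fixes f :: "'c::finite \<Rightarrow> real"
  assumes f: "\<And>c. 0 \<le> f c"
    and freq: "\<And>c. \<bar>(\<Sum>i=1..n. indicator {c} (s i)) - pmf \<mu> c * real n\<bar> \<le> \<eta> * pmf \<mu> c * real n"
  shows "(1 - \<eta>) * measure_pmf.expectation \<mu> f * real n \<le> (\<Sum>i=1..n. f (s i))"
    and "(\<Sum>i=1..n. f (s i)) \<le> (1 + \<eta>) * measure_pmf.expectation \<mu> f * real n"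
proof -
  let ?k = "\<lambda>c. \<Sum>i=1..n. indicator {c} (s i) :: real"
  have k: "(1 - \<eta>) * pmf \<mu> c * real n \<le> ?k c" "?k c \<le> (1 + \<eta>) * pmf \<mu> c * real n" for c
    using freq[of c] unfolding abs_le_iff by (simp_all add: algebra_simps)
  have E: "a * measure_pmf.expectation \<mu> f * real n = (\<Sum>c\<in>UNIV. f c * (a * pmf \<mu> c * real n))" for a
    by (simp add: expectation_finite_pmf sum_distrib_left sum_distrib_right mult_ac)
  show "(1 - \<eta>) * measure_pmf.expectation \<mu> f * real n \<le> (\<Sum>i=1..n. f (s i))"
    unfolding E by (subst sum_along_path) (intro sum_mono mult_left_mono k f)
  show "(\<Sum>i=1..n. f (s i)) \<le> (1 + \<eta>) * measure_pmf.expectation \<mu> f * real n"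
    unfolding E by (subst sum_along_path) (intro sum_mono mult_left_mono k f)
qed

text \<open>The frequency bounds hold at \<open>R\<close>, which exceeds \<open>n0\<close>. The
  passing inequality at \<open>R\<close> bounds \<open>R\<close> below, an explicit passing round
  bounds it above, and the sum of \<open>y\<close> up to \<open>R\<close> is close to
  \<open>\<Delta> * R\<close>.\<close>

lemma wall_clock_typical_path:
  fixes x y :: "'c::finite \<Rightarrow> real"
  assumes "0 < a" and x: "\<And>c. a \<le> x c" and y: "\<And>c. 0 \<le> y c"
    and \<eta>: "0 < \<eta>" "\<eta> < 1" and "real n0 \<le> a"
    and freq: "\<And>n c. n0 \<le> n \<Longrightarrow>
      \<bar>(\<Sum>i=1..n. indicator {c} (s i)) - pmf \<mu> c * real n\<bar> \<le> \<eta> * pmf \<mu> c * real n"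
  defines "\<rho> \<equiv> measure_pmf.expectation \<mu> x" and "\<Delta> \<equiv> measure_pmf.expectation \<mu> y"
    and "R \<equiv> first_passage (\<lambda>n. x (s n))"
  shows "(1 - \<eta>)\<^sup>2 * (\<rho> * \<Delta>) \<le> (\<Sum>n=1..R. y (s n))"
    and "(\<Sum>n=1..R. y (s n)) \<le> (1 + \<eta>) * ((1 + \<eta>) * \<rho> + 1) * \<Delta>"
proof -
  have x0: "0 \<le> x c" for c using x[of c] \<open>0 < a\<close> by linarith
  have \<Delta>: "0 \<le> \<Delta>" unfolding \<Delta>_def using y by (intro Bochner_Integration.integral_nonneg)
  have \<rho>: "a \<le> \<rho>"
    unfolding \<rho>_def using x by (intro measure_pmf.integral_ge_const integrable_measure_pmf_finite AE_I2) auto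
  define b where "b = (\<Sum>c\<in>UNIV. x c)"
  have b: "x c \<le> b" for c unfolding b_def using x0 by (intro member_le_sum) auto
  have "0 \<le> b" unfolding b_def using x0 by (intro sum_nonneg)
  note R = first_passage_bounded[of "\<lambda>n. x (s n)", OF b \<open>0 \<le> b\<close>, folded R_def]
  \<comment> \<open>Every summand is at least \<open>a\<close> while the total is below
    \<open>R\<^sup>2\<close>; hence \<open>R > a \<ge> n0\<close>.\<close>
  have "real R * a = (\<Sum>n=1..R. a)" by simp
  also have "\<dots> \<le> (\<Sum>n=1..R. x (s n))" using x by (intro sum_mono)
  also have "\<dots> < real R * real R" using R(2) by (simp only: power2_eq_square)
  finally have "a < real R" using R(1) by simp
  then have "n0 \<le> R" using \<open>real n0 \<le> a\<close> by linarith
  note freq_R = freq[OF \<open>n0 \<le> R\<close>]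
  have "(1 - \<eta>) * \<rho> * real R < real R * real R"
    using sum_along_typical_path(1)[of x, OF x0 freq_R] R(2) unfolding \<rho>_def power2_eq_square by linarith
  then have lower: "(1 - \<eta>) * \<rho> \<le> real R" using R(1) by simp
  \<comment> \<open>The first integer above \<open>(1 + \<eta>) * \<rho>\<close>: the sum up to it
    is at most \<open>(1 + \<eta>) * \<rho> * r < r\<^sup>2\<close>, so it passes.\<close>
  define r where "r = nat \<lfloor>(1 + \<eta>) * \<rho>\<rfloor> + 1"
  have "\<rho> \<le> (1 + \<eta>) * \<rho>" using \<eta> \<rho> \<open>0 < a\<close> by (simp add: distrib_right)
  then have r: "1 \<le> r" "(1 + \<eta>) * \<rho> < real r" "real r \<le> (1 + \<eta>) * \<rho> + 1" "n0 \<le> r"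
    unfolding r_def using \<rho> \<open>0 < a\<close> \<open>real n0 \<le> a\<close> by linarith+
  have "(\<Sum>n=1..r. x (s n)) \<le> (1 + \<eta>) * \<rho> * real r"
    unfolding \<rho>_def by (rule sum_along_typical_path(2)[OF x0 freq[OF r(4)]])
  also have "\<dots> < real r * real r" using r(1,2) by (intro mult_strict_right_mono) auto
  finally have "R \<le> r" unfolding R_def using r(1) by (intro first_passage_le) (simp_all only: power2_eq_square)
  then have upper: "real R \<le> (1 + \<eta>) * \<rho> + 1" using r(3) by linarith
  have "(1 - \<eta>)\<^sup>2 * (\<rho> * \<Delta>) = (1 - \<eta>) * \<Delta> * ((1 - \<eta>) * \<rho>)" by (simp add: power2_eq_square)
  also have "\<dots> \<le> (1 - \<eta>) * \<Delta> * real R" using lower \<eta> \<Delta> by (intro mult_left_mono) auto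
  also have "\<dots> \<le> (\<Sum>n=1..R. y (s n))"
    unfolding \<Delta>_def by (rule sum_along_typical_path(1)[OF y freq_R])
  finally show "(1 - \<eta>)\<^sup>2 * (\<rho> * \<Delta>) \<le> (\<Sum>n=1..R. y (s n))" .
  have "(\<Sum>n=1..R. y (s n)) \<le> (1 + \<eta>) * \<Delta> * real R"
    unfolding \<Delta>_def by (rule sum_along_typical_path(2)[OF y freq_R])
  also have "\<dots> \<le> (1 + \<eta>) * \<Delta> * ((1 + \<eta>) * \<rho> + 1)" using upper \<eta> \<Delta> by (intro mult_left_mono) auto
  finally show "(\<Sum>n=1..R. y (s n)) \<le> (1 + \<eta>) * ((1 + \<eta>) * \<rho> + 1) * \<Delta>" by (simp only: mult_ac)
qed

lemma value_le_expectation: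
  fixes f :: "'c::finite \<Rightarrow> real"
  assumes "\<And>c. 0 \<le> f c" "0 < m" "\<And>c. m \<le> pmf \<mu> c"
  shows "f c \<le> measure_pmf.expectation \<mu> f / m"
proof -
  have "f c * m \<le> pmf \<mu> c * f c" using assms by (subst mult.commute) (intro mult_right_mono)
  also have "\<dots> \<le> measure_pmf.expectation \<mu> f"
    unfolding expectation_finite_pmf using assms(1) by (intro member_le_sum) auto
  finally show ?thesis using \<open>0 < m\<close> by (simp add: pos_le_divide_eq)
qed

text \<open>The bound for exceptional paths, where nothing is known about frequencies. It rests on
  pointwise bounds by the means, so it stays proportional to \<open>\<Delta>\<close> and nearly so
  to \<open>\<rho>\<close>, uniformly in the policy.\<close>

lemma wall_clock_any_path:
  fixes x y :: "'c::finite \<Rightarrow> real"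
  assumes x: "\<And>c. 0 \<le> x c" and y: "\<And>c. 0 \<le> y c" and m: "0 < m" "\<And>c. m \<le> pmf \<mu> c"
  shows "(\<Sum>n=1..first_passage (\<lambda>n. x (s n)). y (s n)) \<le>
    (measure_pmf.expectation \<mu> x / m + 1) * (measure_pmf.expectation \<mu> y / m)"
proof -
  let ?\<rho> = "measure_pmf.expectation \<mu> x" and ?\<Delta> = "measure_pmf.expectation \<mu> y"
  let ?R = "first_passage (\<lambda>n. x (s n))"
  have nonneg: "0 \<le> ?\<rho> / m" "0 \<le> ?\<Delta> / m"
    using x y m(1) by (auto intro!: divide_nonneg_pos Bochner_Integration.integral_nonneg)
  have "(\<Sum>n=1..?R. y (s n)) \<le> (\<Sum>n=1..?R. ?\<Delta> / m)"
    by (intro sum_mono value_le_expectation y m)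
  also have "\<dots> = real ?R * (?\<Delta> / m)" by simp
  also have "\<dots> \<le> (?\<rho> / m + 1) * (?\<Delta> / m)"
    using nonneg value_le_expectation[of x, OF x m]
    by (intro mult_right_mono first_passage_bounded(3)) auto
  finally show ?thesis .
qed

section \<open>Expected wall clock time\<close>

text \<open>The random upper limit is countably valued, and for each fixed limit the sum is
  measurable.\<close>

lemma wall_clock_measurable:
  fixes C :: "nat \<Rightarrow> 'w \<Rightarrow> 'c::finite" and x y :: "'c \<Rightarrow> real"
  assumes mc: "markov_chain M C K"
  shows "(\<lambda>\<omega>. \<Sum>n=1..first_passage (\<lambda>n. x (C n \<omega>)). y (C n \<omega>)) \<in> borel_measurable M"
proof -
  have S [measurable]: "(\<lambda>\<omega>. \<Sum>n=1..r. f (C n \<omega>)) \<in> borel_measurable M" for r and f :: "'c \<Rightarrow> real"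
    by (intro borel_measurable_sum measurable_compose[OF markov_chain_measurable[OF mc]]) auto
  have "(\<lambda>\<omega>. first_passage (\<lambda>n. x (C n \<omega>))) \<in> measurable M (count_space UNIV)"
    unfolding first_passage_def by measurable
  from measurable_compose_countable[OF S this] show ?thesis .
qed

text \<open>On \<open>G\<close> the typical bounds hold, with the rounding term absorbed by
  \<open>1 \<le> \<eta> * a \<le> \<eta> * \<rho>\<close>. The complement has probability at most
  \<open>\<eta> * m\<^sup>2 / 2\<close>, chosen to cancel the factor \<open>2 / m\<^sup>2\<close> of
  the crude bound.\<close>

lemma expected_wall_clock_bounds:
  fixes C :: "nat \<Rightarrow> 'w \<Rightarrow> 'c::finite" and x y :: "'c \<Rightarrow> real"
  assumes mc: "markov_chain M C K"
    and m: "0 < m" "m \<le> 1" "\<And>c. m \<le> pmf \<mu> c"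
    and "0 < a" and x: "\<And>c. a \<le> x c" and y: "\<And>c. 0 < y c"
    and \<eta>: "0 < \<eta>" "\<eta> < 1" and a: "1 \<le> \<eta> * a" "real n0 \<le> a"
    and G: "G \<in> sets M" "1 - \<eta> * m\<^sup>2 / 2 \<le> measure M G"
    and freq: "\<forall>\<omega>\<in>G. \<forall>n\<ge>n0. \<forall>c.
      \<bar>(\<Sum>i=1..n. indicator {c} (C i \<omega>)) - pmf \<mu> c * real n\<bar> \<le> \<eta> * pmf \<mu> c * real n"
  defines "T \<equiv> \<lambda>\<omega>. \<Sum>n=1..first_passage (\<lambda>n. x (C n \<omega>)). y (C n \<omega>)"
    and "P \<equiv> measure_pmf.expectation \<mu> x * measure_pmf.expectation \<mu> y"
  shows "integrable M T" and "0 < P"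
    and "(1 - 3 * \<eta>) * P \<le> (\<integral>\<omega>. T \<omega> \<partial>M)"
    and "(\<integral>\<omega>. T \<omega> \<partial>M) \<le> (1 + 6 * \<eta>) * P"
proof -
  interpret prob_space M using mc by (rule markov_chain_prob_space)
  define \<rho> where "\<rho> = measure_pmf.expectation \<mu> x"
  define \<Delta> where "\<Delta> = measure_pmf.expectation \<mu> y"
  have x0: "0 \<le> x c" and y0: "0 \<le> y c" for c
    using x[of c] y[of c] \<open>0 < a\<close> by linarith+
  have "a \<le> \<rho>"
    unfolding \<rho>_def using x by (intro measure_pmf.integral_ge_const integrable_measure_pmf_finite AE_I2) auto
  have "1 \<le> \<eta> * \<rho>"
    using a(1) mult_left_mono[OF \<open>a \<le> \<rho>\<close>, of \<eta>] \<eta>(1) by linarith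
  moreover have "\<eta> * \<rho> \<le> 1 * \<rho>" using \<eta> \<open>a \<le> \<rho>\<close> \<open>0 < a\<close> by (intro mult_right_mono) auto
  ultimately have "1 \<le> \<rho>" by linarith
  have "0 < \<Delta>"
    unfolding \<Delta>_def expectation_finite_pmf
  proof (intro sum_pos mult_pos_pos y)
    fix c show "0 < pmf \<mu> c" using m(1) m(3)[of c] by linarith
  qed auto
  then have "0 < \<rho> * \<Delta>" using \<open>1 \<le> \<rho>\<close> by simp
  then show "0 < P" by (simp add: P_def \<rho>_def \<Delta>_def)
  have typical: "(1 - \<eta>)\<^sup>2 * (\<rho> * \<Delta>) \<le> T \<omega>" "T \<omega> \<le> (1 + \<eta>) * ((1 + \<eta>) * \<rho> + 1) * \<Delta>"
    if "\<omega> \<in> G" for \<omega>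
    unfolding T_def \<rho>_def \<Delta>_def
    by (rule wall_clock_typical_path[OF \<open>0 < a\<close> x y0 \<eta> a(2)], use freq that in blast)+
  have T0: "0 \<le> T \<omega>" for \<omega> unfolding T_def using y0 by (intro sum_nonneg)
  \<comment> \<open>The crude bound once \<open>\<rho> / m + 1\<close> is replaced by
    \<open>2 * (\<rho> / m)\<close>, using \<open>m \<le> 1 \<le> \<rho>\<close>.\<close>
  define W where "W = 2 * (\<rho> * \<Delta>) / m\<^sup>2"
  have any: "T \<omega> \<le> W" for \<omega>
  proof -
    have "T \<omega> \<le> (\<rho> / m + 1) * (\<Delta> / m)"
      unfolding T_def \<rho>_def \<Delta>_def by (rule wall_clock_any_path[OF x0 y0 m(1,3)])
    also have "\<dots> \<le> (2 * (\<rho> / m)) * (\<Delta> / m)"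
    proof (rule mult_right_mono)
      have "m \<le> \<rho>" using m(2) \<open>1 \<le> \<rho>\<close> by linarith
      then have "1 \<le> \<rho> / m" using m(1) by (simp add: le_divide_eq)
      then show "\<rho> / m + 1 \<le> 2 * (\<rho> / m)" by linarith
      show "0 \<le> \<Delta> / m" using m(1) \<open>0 < \<Delta>\<close> by simp
    qed
    also have "\<dots> = W" by (simp add: W_def power2_eq_square)
    finally show ?thesis .
  qed
  have T_meas: "T \<in> borel_measurable M"
    unfolding T_def by (rule wall_clock_measurable[OF mc])
  show int: "integrable M T"
    by (rule integrable_const_bound[of _ W]) (use any T0 T_meas in auto)
  have int_ind: "integrable M (\<lambda>\<omega>. b * indicator A \<omega>)" if "A \<in> sets M" for b :: real and A
    using that by (intro integrable_mult_right) (auto simp: emeasure_eq_measure)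
  have small: "(1 - \<eta>)\<^sup>2 \<ge> 0" "\<eta> * m\<^sup>2 / 2 \<le> \<eta>"
    using m(1,2) \<eta> power_le_one[of m 2] mult_left_mono[of "m\<^sup>2" 1 \<eta>] by auto
  show "(1 - 3 * \<eta>) * P \<le> (\<integral>\<omega>. T \<omega> \<partial>M)"
  proof -
    \<comment> \<open>This product is \<open>(1 - \<eta>)\<^sup>3 - (1 - 3 * \<eta>)\<close>; one
      factor \<open>1 - \<eta>\<close> comes from the probability of \<open>G\<close>, two from the
      typical bound.\<close>
    have "0 \<le> \<eta>\<^sup>2 * (3 - \<eta>)" using \<eta> by simp
    then have "1 - 3 * \<eta> \<le> (1 - \<eta>)\<^sup>2 * (1 - \<eta>)" by (simp add: power2_eq_square algebra_simps)
    also have "\<dots> \<le> (1 - \<eta>)\<^sup>2 * measure M G" using small G(2) by (intro mult_left_mono) auto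
    finally have "(1 - 3 * \<eta>) * (\<rho> * \<Delta>) \<le> (1 - \<eta>)\<^sup>2 * measure M G * (\<rho> * \<Delta>)"
      using \<open>0 < \<rho> * \<Delta>\<close> by (intro mult_right_mono) auto
    also have "\<dots> = (\<integral>\<omega>. (1 - \<eta>)\<^sup>2 * (\<rho> * \<Delta>) * indicator G \<omega> \<partial>M)"
      using G(1) by (simp add: sets.Int_space_eq2)
    also have "\<dots> \<le> (\<integral>\<omega>. T \<omega> \<partial>M)"
      using typical(1) T0 by (intro integral_mono int int_ind G(1)) (auto simp: indicator_def)
    finally show ?thesis by (simp only: P_def \<rho>_def \<Delta>_def)
  qed
  show "(\<integral>\<omega>. T \<omega> \<partial>M) \<le> (1 + 6 * \<eta>) * P"
  proof -
    define U where "U = (1 + \<eta>) * ((1 + \<eta>) * \<rho> + 1) * \<Delta>"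
    have "0 \<le> U" unfolding U_def using \<eta> \<open>1 \<le> \<rho>\<close> \<open>0 < \<Delta>\<close> by (intro mult_nonneg_nonneg) auto
    have "0 \<le> W" using any T0 order_trans by blast
    have "(\<integral>\<omega>. T \<omega> \<partial>M) \<le> (\<integral>\<omega>. U + W * indicator (space M - G) \<omega> \<partial>M)"
    proof (intro integral_mono int Bochner_Integration.integrable_add int_ind)
      fix \<omega> assume "\<omega> \<in> space M"
      then show "T \<omega> \<le> U + W * indicator (space M - G) \<omega>"
        using typical(2)[of \<omega>] any[of \<omega>] \<open>0 \<le> U\<close> by (cases "\<omega> \<in> G") (auto simp: U_def)
    qed (use G(1) in auto)
    also have "\<dots> = U + W * measure M (space M - G)"
      using G(1) int_ind[of "space M - G" W] by (simp add: prob_space sets.Int_space_eq2)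
    also have "\<dots> \<le> U + W * (\<eta> * m\<^sup>2 / 2)"
      using G \<open>0 \<le> W\<close> by (intro add_left_mono mult_left_mono) (auto simp: prob_compl)
    also have "\<dots> = U + \<eta> * (\<rho> * \<Delta>)" using m(1) by (simp add: W_def)
    also have "\<dots> \<le> (1 + 5 * \<eta>) * (\<rho> * \<Delta>) + \<eta> * (\<rho> * \<Delta>)"
    proof (rule add_right_mono)
      \<comment> \<open>Replacing the rounding term 1 by \<open>\<eta> * \<rho>\<close> leaves
        \<open>(1 + \<eta>) * (1 + 2 * \<eta>)\<close>, at most \<open>1 + 5 * \<eta>\<close>; the
        exceptional event adds one more \<open>\<eta>\<close>.\<close>
      have "U \<le> (1 + \<eta>) * ((1 + \<eta>) * \<rho> + \<eta> * \<rho>) * \<Delta>"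
        unfolding U_def using \<open>1 \<le> \<eta> * \<rho>\<close> \<eta> \<open>0 < \<Delta>\<close> by (intro mult_right_mono mult_left_mono) auto
      also have "\<dots> = (1 + 3 * \<eta> + 2 * (\<eta> * \<eta>)) * (\<rho> * \<Delta>)" by (simp add: algebra_simps)
      also have "\<dots> \<le> (1 + 5 * \<eta>) * (\<rho> * \<Delta>)"
        using \<eta> \<open>0 < \<rho> * \<Delta>\<close> mult_left_mono[of \<eta> 1 \<eta>] by (intro mult_right_mono) auto
      finally show "U \<le> (1 + 5 * \<eta>) * (\<rho> * \<Delta>)" .
    qed
    finally have "(\<integral>\<omega>. T \<omega> \<partial>M) \<le> (1 + 6 * \<eta>) * (\<rho> * \<Delta>)" by (simp add: algebra_simps)
    then show ?thesis by (simp only: P_def \<rho>_def \<Delta>_def)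
  qed
qed

section \<open>Choice of the constants, uniformly in the policy\<close>

theorem lemma2:
  fixes qmax :: real
    and \<tau> :: nat
    and reached :: "'m::finite fl_algorithm"
    and N :: "real ^ 'm \<Rightarrow> real"
    and h :: "real \<Rightarrow> real \<Rightarrow> real"
    and d :: "nat \<Rightarrow> real ^ 'm \<Rightarrow> 'c::finite \<Rightarrow> real"
    and M :: "'w measure"
    and C :: "nat \<Rightarrow> 'w \<Rightarrow> 'c"
    and K :: "'c \<Rightarrow> 'c pmf"
    and \<mu> :: "'c pmf"
  assumes "qmax > 0"
    and "\<And>q c. q \<in> params qmax \<Longrightarrow> d \<tau> q c > 0"
    and "convergence_criterion qmax reached N h"
    and "polynomial_rounds qmax reached"
    and "duration_regular qmax h d \<tau>"
    and "stationary_markov_chain M C K \<mu>"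
    and "irreducible_kernel K"
    and "aperiodic_kernel K"
  shows "\<forall>\<delta>>0. \<exists>\<epsilon>th>0. \<forall>\<epsilon>. 0 < \<epsilon> \<and> \<epsilon> < \<epsilon>th \<longrightarrow>
    (\<forall>\<pi> :: 'c \<Rightarrow> real ^ 'm. (\<forall>c. \<pi> c \<in> params qmax) \<longrightarrow>
      integrable M (wall_clock reached d \<tau> C \<epsilon> \<pi>) \<and>
      (let ratio = (\<integral>\<omega>. wall_clock reached d \<tau> C \<epsilon> \<pi> \<omega> \<partial>M) /
             (measure_pmf.expectation \<mu> (\<lambda>c. N (coordwise (h \<epsilon>) (\<pi> c))) *
              measure_pmf.expectation \<mu> (\<lambda>c. d \<tau> (\<pi> c) c))
       in 1 - \<delta> \<le> ratio \<and> ratio \<le> 1 + \<delta>))"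
proof (intro allI impI)
  fix \<delta> :: real assume "\<delta> > 0"
  have mc: "markov_chain M C K" and inv: "bind_pmf \<mu> K = \<mu>"
    using assms(6) unfolding stationary_markov_chain_def by blast+
  define m where "m = Min (range (pmf \<mu>))"
  have m_le: "m \<le> pmf \<mu> c" for c by (simp add: m_def)
  have "m \<in> range (pmf \<mu>)" unfolding m_def by (intro Min_in) auto
  then have m: "0 < m" "m \<le> 1"
    using invariant_pmf_pos[OF assms(7) inv] pmf_le_1[of \<mu>] by auto
  \<comment> \<open>The upper estimate loses \<open>6 * \<eta>\<close>, the lower one only
    \<open>3 * \<eta>\<close>; the cap keeps \<open>\<eta> < 1\<close>.\<close>
  define \<eta> where "\<eta> = min (\<delta> / 6) (1 / 2)"
  have \<eta>: "0 < \<eta>" "\<eta> < 1" "6 * \<eta> \<le> \<delta>" using \<open>\<delta> > 0\<close> by (auto simp: \<eta>_def)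
  have "0 < \<eta> * m\<^sup>2 / 2" using \<eta>(1) m(1) by simp
  obtain n0 G where G: "G \<in> sets M" "1 - \<eta> * m\<^sup>2 / 2 \<le> measure M G"
    and freq: "\<forall>\<omega>\<in>G. \<forall>n\<ge>n0. \<forall>c.
      \<bar>(\<Sum>i=1..n. indicator {c} (C i \<omega>)) - pmf \<mu> c * real n\<bar> \<le> \<eta> * pmf \<mu> c * real n"
    by (rule uniform_visit_frequencies[OF mc assms(7) inv \<eta>(1) \<open>0 < \<eta> * m\<^sup>2 / 2\<close>])
  \<comment> \<open>The norms must exceed \<open>n0\<close>, so that stopping occurs in the typical
    regime, and \<open>1 / \<eta>\<close>, so that rounding is negligible. Both depend on the chain
    and \<open>\<delta>\<close> alone.\<close>
  define a where "a = max (real n0) (1 / \<eta>)"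
  have a: "real n0 \<le> a" "0 < a" "1 \<le> \<eta> * a"
  proof -
    have "1 / \<eta> \<le> a" by (simp add: a_def)
    then show "1 \<le> \<eta> * a" using \<eta>(1) by (simp add: field_simps)
    have "0 < 1 / \<eta>" using \<eta>(1) by simp
    then show "0 < a" using \<open>1 / \<eta> \<le> a\<close> by linarith
    show "real n0 \<le> a" unfolding a_def by (rule max.cobounded1)
  qed
  \<comment> \<open>The lower bound covers all admissible parameters at once, so the threshold is
    fixed before any policy is chosen.\<close>
  obtain \<epsilon>th where \<epsilon>th: "\<epsilon>th > 0"
    "\<And>\<epsilon> q. 0 < \<epsilon> \<Longrightarrow> \<epsilon> < \<epsilon>th \<Longrightarrow> q \<in> params qmax \<Longrightarrow> a \<le> N (coordwise (h \<epsilon>) q)"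
    using criterion_norm_large[OF assms(1,3,4), of a]
    unfolding eventually_at_right_field by blast
  show "\<exists>\<epsilon>th>0. \<forall>\<epsilon>. 0 < \<epsilon> \<and> \<epsilon> < \<epsilon>th \<longrightarrow>
    (\<forall>\<pi> :: 'c \<Rightarrow> real ^ 'm. (\<forall>c. \<pi> c \<in> params qmax) \<longrightarrow>
      integrable M (wall_clock reached d \<tau> C \<epsilon> \<pi>) \<and>
      (let ratio = (\<integral>\<omega>. wall_clock reached d \<tau> C \<epsilon> \<pi> \<omega> \<partial>M) /
             (measure_pmf.expectation \<mu> (\<lambda>c. N (coordwise (h \<epsilon>) (\<pi> c))) *
              measure_pmf.expectation \<mu> (\<lambda>c. d \<tau> (\<pi> c) c))
       in 1 - \<delta> \<le> ratio \<and> ratio \<le> 1 + \<delta>))"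
  proof (intro exI conjI allI impI)
    show "\<epsilon>th > 0" by (rule \<epsilon>th(1))
    fix \<epsilon> and \<pi> :: "'c \<Rightarrow> real ^ 'm"
    assume "0 < \<epsilon> \<and> \<epsilon> < \<epsilon>th" and \<pi>: "\<forall>c. \<pi> c \<in> params qmax"
    then have \<epsilon>: "0 < \<epsilon>" "\<epsilon> < \<epsilon>th" by blast+
    define x where "x c = N (coordwise (h \<epsilon>) (\<pi> c))" for c
    define y where "y c = d \<tau> (\<pi> c) c" for c
    have x: "a \<le> x c" for c unfolding x_def using \<epsilon>th(2)[OF \<epsilon>] \<pi> by blast
    have y: "0 < y c" for c unfolding y_def using assms(2) \<pi> by blast
    have "param_seq qmax (policy_params \<pi> C \<omega>)" for \<omega>
      using \<pi> by (simp add: param_seq_def policy_params_def)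
    then have rounds: "min_rounds reached \<epsilon> (policy_params \<pi> C \<omega>) = first_passage (\<lambda>n. x (C n \<omega>))" for \<omega>
      unfolding x_def by (subst min_rounds_eq_first_passage[OF assms(3) \<epsilon>(1)]) (simp_all add: policy_params_def)
    have T: "wall_clock reached d \<tau> C \<epsilon> \<pi> = (\<lambda>\<omega>. \<Sum>n=1..first_passage (\<lambda>n. x (C n \<omega>)). y (C n \<omega>))"
      by (rule ext) (simp only: wall_clock_def rounds y_def)
    note bounds = expected_wall_clock_bounds[where x = x and y = y,
        OF mc m m_le a(2) x y \<eta>(1,2) a(3,1) G freq, folded T]
    show "integrable M (wall_clock reached d \<tau> C \<epsilon> \<pi>)" by (rule bounds(1))
    have "1 - \<delta> \<le> (\<integral>\<omega>. wall_clock reached d \<tau> C \<epsilon> \<pi> \<omega> \<partial>M) /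
        (measure_pmf.expectation \<mu> x * measure_pmf.expectation \<mu> y)"
    proof -
      have "1 - \<delta> \<le> 1 - 3 * \<eta>" using \<eta> by linarith
      also have "\<dots> \<le> (\<integral>\<omega>. wall_clock reached d \<tau> C \<epsilon> \<pi> \<omega> \<partial>M) /
        (measure_pmf.expectation \<mu> x * measure_pmf.expectation \<mu> y)"
        by (subst pos_le_divide_eq[OF bounds(2)]) (rule bounds(3))
      finally show ?thesis .
    qed
    moreover have "(\<integral>\<omega>. wall_clock reached d \<tau> C \<epsilon> \<pi> \<omega> \<partial>M) /
        (measure_pmf.expectation \<mu> x * measure_pmf.expectation \<mu> y) \<le> 1 + \<delta>"
    proof -
      have "(\<integral>\<omega>. wall_clock reached d \<tau> C \<epsilon> \<pi> \<omega> \<partial>M) /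
        (measure_pmf.expectation \<mu> x * measure_pmf.expectation \<mu> y) \<le> 1 + 6 * \<eta>"
        by (subst pos_divide_le_eq[OF bounds(2)]) (rule bounds(4))
      also have "\<dots> \<le> 1 + \<delta>" using \<eta> by linarith
      finally show ?thesis .
    qed
    ultimately show "let ratio = (\<integral>\<omega>. wall_clock reached d \<tau> C \<epsilon> \<pi> \<omega> \<partial>M) /
             (measure_pmf.expectation \<mu> (\<lambda>c. N (coordwise (h \<epsilon>) (\<pi> c))) *
              measure_pmf.expectation \<mu> (\<lambda>c. d \<tau> (\<pi> c) c))
       in 1 - \<delta> \<le> ratio \<and> ratio \<le> 1 + \<delta>"
      unfolding Let_def x_def[abs_def] y_def[abs_def] by blast
  qed
qed

end
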